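(* Let $M$ be an $m$-dimensional manifold, let $\gamma$ be a tangent metric on the tangent manifold $\mathcal{T}M$, and let $\mathfrak{g}_\gamma$ be its extension to the vertical tangent manifold $\mathcal{T}(\mathcal{V})$. Then the restriction of $\mathfrak{g}_\gamma$ to the leaves of the double vertical foliation $\mathfrak{V}$ is a (pseudo) Kähler metric (with respect to the complex structure $\mathfrak{J}_{\mathfrak{V}}$ of the leaves) if and only if $\gamma$ is locally Lagrange.
   Context: Everything is $C^\infty$. "(Pseudo)" means that metrics need only be non-degenerate, not necessarily positive definite. Tangent manifold. $\mathcal{T}M$ is the total space of $\pi:TM\to M$, with local coordinates $(x^i,y^i)$, $i=1,\dots,m$, where $x^i$ are local coordinates on $M$ and $y^i$ are the vector coordinates with respect to $\partial/\partial x^i$. $\mathcal{V}$ denotes both the vertical foliation (by the fibers) and its tangent bundle, locally spanned by $\partial/\partial y^i$. The tangent structure $S\in \mathrm{End}(T\mathcal{T}M)$ is given by $S(\partial/\partial x^i)=\partial/\partial y^i$, $S(\partial/\partial y^i)=0$. Tangent metrics. A tangent metric on $\mathcal{T}M$ is a (pseudo) Riemannian metric $\gamma$ whose restriction to $\mathcal{V}$ is non-degenerate and such that $\gamma(S\mathcal{X},S\mathcal{X}')=\gamma(\mathcal{X},\mathcal{X}')$ for all $\mathcal{X},\mathcal{X}'\in\mathcal{H}:=\mathcal{V}^{\perp_\gamma}$. Then $\mathcal{H}\oplus\mathcal{V}=T\mathcal{T}M$. Writing $X_i=\partial/\partial x^i-t_i^j\,\partial/\partial y^j\in\mathcal{H}$,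 $\theta^i=dy^i+t^i_jdx^j$ and $g_{ij}=\gamma(X_i,X_j)$, one has $\gamma=g_{ij}dx^i\otimes dx^j+g_{ij}\theta^i\otimes\theta^j$, with $g_{ij}=g_{ij}(x,y)$; put $g=\gamma|_{\mathcal{H}}$. The metric $\gamma$ is a Lagrange metric if $g_{ij}=\partial^2\mathcal{L}/\partial y^i\partial y^j$ for a function $\mathcal{L}$ on $\mathcal{T}M$ (continuous, and smooth outside the zero section); it is locally Lagrange if each point has a neighborhood on which $\gamma$ is of this form for a locally defined function $\mathcal{L}$. Vertical tangent manifold. $\mathcal{T}(\mathcal{V})$ is the total space of the tangent bundle of the vertical leaves, a $3m$-dimensional manifold with local coordinates $(x^i,y^i,\eta^i)$, $\eta^i$ being vector coordinates with respect to $\partial/\partial y^i$; both $y^i$ and $\eta^i$ transform by $\tilde y^i=(\partial\tilde x^i/\partial x^j)y^j$, $\tilde\eta^i=(\partial\tilde x^i/\partial x^j)\eta^j$. The double vertical foliation $\mathfrak{V}=\mathcal{V}_1\oplus\mathcal{V}_2$ is the foliation by the fibers of $p:\mathcal{T}(\mathcal{V})\to M$, $p(x,y,\eta)=x$, where $\mathcal{V}_1=\mathrm{span}\{\partial/\partial y^i\}$ and $\mathcal{V}_2=\mathrm{span}\{\partial/\partial\eta^i\}$. The leaves of $\mathfrak{V}$ carry the complex structure $\mathfrak{J}_{\mathfrak{V}}(\partial/\partial y^i)=\partial/\partial\eta^i$, $\mathfrak{J}_{\mathfrak{V}}(\partial/\partial\eta^i)=-\partial/\partial y^i$, so that $z^i=y^i+\sqrt{-1}\,\eta^i$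 are holomorphic coordinates along the leaves. Extension. The extension $\mathfrak{g}_\gamma$ of $\gamma$ is the metric on $\mathcal{T}(\mathcal{V})$ obtained by identifying the pair $(\mathcal{H},g)$ with a similar pair (a complement of $\mathfrak{V}$ with a metric on it) on $\mathcal{T}(\mathcal{V})$, taking this complement orthogonal to $\mathfrak{V}$ and $\mathcal{V}_1\perp\mathcal{V}_2$, with both $\mathcal{V}_1,\mathcal{V}_2$ carrying the metric with the same components $g_{ij}(x,y)$. In particular its restriction to each leaf $x=\mathrm{const}$ of $\mathfrak{V}$ is $g_{ij}(x,y)\,(dy^i\otimes dy^j+d\eta^i\otimes d\eta^j)$, which is all that matters here. *)

theory Defs
  imports "HOL-Analysis.Analysis"
begin

section \<open>Smooth functions on open subsets of Euclidean spaces\<close>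

primrec Ck_on :: "nat \<Rightarrow> 'e::euclidean_space set \<Rightarrow> ('e \<Rightarrow> 'f::real_normed_vector) \<Rightarrow> bool" where
  "Ck_on 0 S f \<longleftrightarrow> continuous_on S f"
| "Ck_on (Suc k) S f \<longleftrightarrow>
     (\<forall>x\<in>S. f differentiable (at x)) \<and>
     (\<forall>v. Ck_on k S (\<lambda>x. frechet_derivative f (at x) v))"

(* Only used for open S. *)
definition smooth_on :: "'e::euclidean_space set \<Rightarrow> ('e \<Rightarrow> 'f::real_normed_vector) \<Rightarrow> bool" where
  "smooth_on S f \<longleftrightarrow> (\<forall>k. Ck_on k S f)"

section \<open>Smooth manifolds given by an atlas\<close>

(* A chart is a pair (domain, coordinate map); values of the map outside the domain are irrelevant. *)
type_synonym ('a, 'e) chart = "'a set \<times> ('a \<Rightarrow> 'e)"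

definition cinv :: "('a, 'e) chart \<Rightarrow> 'e \<Rightarrow> 'a" where
  "cinv c = inv_into (fst c) (snd c)"

definition carrier_of :: "('a, 'e) chart set \<Rightarrow> 'a set" where
  "carrier_of A = (\<Union>c\<in>A. fst c)"

definition smooth_atlas :: "('a, 'e::euclidean_space) chart set \<Rightarrow> bool" where
  "smooth_atlas A \<longleftrightarrow>
     (\<forall>c\<in>A. inj_on (snd c) (fst c) \<and> open (snd c ` fst c)) \<and>
     (\<forall>c\<in>A. \<forall>d\<in>A. open (snd c ` (fst c \<inter> fst d)) \<and>
        smooth_on (snd c ` (fst c \<inter> fst d)) (snd d \<circ> cinv c))"

definition atlas_topology :: "('a, 'e::euclidean_space) chart set \<Rightarrow> 'a topology" where
  "atlas_topology A =
     topology (\<lambda>W. W \<subseteq> carrier_of A \<and> (\<forall>c\<in>A. open (snd c ` (W \<inter> fst c))))"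

lemma openin_atlas_topology:
  assumes "smooth_atlas A"
  shows "openin (atlas_topology A) W \<longleftrightarrow>
           W \<subseteq> carrier_of A \<and> (\<forall>c\<in>A. open (snd c ` (W \<inter> fst c)))"
proof -
  let ?P = "\<lambda>W. W \<subseteq> carrier_of A \<and> (\<forall>c\<in>A. open (snd c ` (W \<inter> fst c)))"
  have "istopology ?P"
    unfolding istopology_def
  proof (intro conjI allI impI)
    fix S T assume S: "?P S" and T: "?P T"
    show "S \<inter> T \<subseteq> carrier_of A" using S by blast
    show "\<forall>c\<in>A. open (snd c ` (S \<inter> T \<inter> fst c))"
    proof
      fix c assume c: "c \<in> A"
      then have inj: "inj_on (snd c) (fst c)"
        using assms unfolding smooth_atlas_def by blast
      have "snd c ` (S \<inter> T \<inter> fst c) = snd c ` (S \<inter> fst c) \<inter> snd c ` (T \<inter> fst c)"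
        using inj unfolding inj_on_def by blast
      then show "open (snd c ` (S \<inter> T \<inter> fst c))"
        using S T c by (metis open_Int)
    qed
  next
    fix K assume K: "\<forall>W\<in>K. ?P W"
    show "\<Union>K \<subseteq> carrier_of A" using K by blast
    show "\<forall>c\<in>A. open (snd c ` (\<Union>K \<inter> fst c))"
    proof
      fix c assume c: "c \<in> A"
      have "snd c ` (\<Union>K \<inter> fst c) = (\<Union>W\<in>K. snd c ` (W \<inter> fst c))" by blast
      then show "open (snd c ` (\<Union>K \<inter> fst c))"
        using K c by (metis (no_types, lifting) open_UN)
    qed
  qed
  then show ?thesis
    unfolding atlas_topology_def by (simp add: topology_inverse')
qed

definition smooth_manifold :: "('a, 'e::euclidean_space) chart set \<Rightarrow> bool" where
  "smooth_manifold A \<longleftrightarrow>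
     smooth_atlas A \<and> Hausdorff_space (atlas_topology A) \<and> second_countable (atlas_topology A)"

definition smooth_function_on ::
    "('a, 'e::euclidean_space) chart set \<Rightarrow> 'a set \<Rightarrow> ('a \<Rightarrow> real) \<Rightarrow> bool" where
  "smooth_function_on A W f \<longleftrightarrow> (\<forall>c\<in>A. smooth_on (snd c ` (W \<inter> fst c)) (f \<circ> cinv c))"

section \<open>Tangent vectors and tangent bundles\<close>

(* A tangent vector at p is the family of its components in all charts of the atlas around p,
   related by the Jacobians of the coordinate changes (and 0 at all other charts). *)
type_synonym ('a, 'e) tvec = "('a, 'e) chart \<Rightarrow> 'e"

definition tangent_space ::
    "('a, 'e::euclidean_space) chart set \<Rightarrow> 'a \<Rightarrow> ('a, 'e) tvec set" where
  "tangent_space A p =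
     {v. (\<forall>c\<in>A. \<forall>d\<in>A. p \<in> fst c \<inter> fst d \<longrightarrow>
            v d = frechet_derivative (snd d \<circ> cinv c) (at (snd c p)) (v c)) \<and>
         (\<forall>c. \<not> (c \<in> A \<and> p \<in> fst c) \<longrightarrow> v c = 0)}"

(* The tangent vector at p with components a in the chart c. *)
definition tvec_of ::
    "('a, 'e::euclidean_space) chart set \<Rightarrow> ('a, 'e) chart \<Rightarrow> 'a \<Rightarrow> 'e \<Rightarrow> ('a, 'e) tvec" where
  "tvec_of A c p a =
     (\<lambda>d. if d \<in> A \<and> p \<in> fst d
          then frechet_derivative (snd d \<circ> cinv c) (at (snd c p)) a else 0)"

definition lincomb ::
    "real \<Rightarrow> ('a, 'e::euclidean_space) tvec \<Rightarrow> real \<Rightarrow> ('a, 'e) tvec \<Rightarrow> ('a, 'e) tvec" where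
  "lincomb a v b w = (\<lambda>c. a *\<^sub>R v c + b *\<^sub>R w c)"

(* The differential at p of a smooth map f between manifolds with atlases A and B; it does not
   depend on the chart of A chosen around p. *)
definition tangent_map ::
    "('a, 'e::euclidean_space) chart set \<Rightarrow> ('b, 'f::euclidean_space) chart set \<Rightarrow>
     ('a \<Rightarrow> 'b) \<Rightarrow> 'a \<Rightarrow> ('a, 'e) tvec \<Rightarrow> ('b, 'f) tvec" where
  "tangent_map A B f p v =
     (\<lambda>d. if d \<in> B \<and> f p \<in> fst d
          then (let c = (SOME c. c \<in> A \<and> p \<in> fst c)
                in frechet_derivative (snd d \<circ> f \<circ> cinv c) (at (snd c p)) (v c))
          else 0)"

definition tangent_bundle ::
    "('a, 'e::euclidean_space) chart set \<Rightarrow> ('a \<times> ('a, 'e) tvec) set" where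
  "tangent_bundle A = {(p, v). p \<in> carrier_of A \<and> v \<in> tangent_space A p}"

(* The induced local coordinates (x, y). *)
definition tangent_chart ::
    "('a, 'e::euclidean_space) chart set \<Rightarrow> ('a, 'e) chart \<Rightarrow> ('a \<times> ('a, 'e) tvec, 'e \<times> 'e) chart"
  where
  "tangent_chart A c =
     ({\<xi> \<in> tangent_bundle A. fst \<xi> \<in> fst c}, \<lambda>\<xi>. (snd c (fst \<xi>), snd \<xi> c))"

definition tangent_atlas ::
    "('a, 'e::euclidean_space) chart set \<Rightarrow> ('a \<times> ('a, 'e) tvec, 'e \<times> 'e) chart set" where
  "tangent_atlas A = tangent_chart A ` A"

definition zero_section :: "('a, 'e::euclidean_space) chart set \<Rightarrow> ('a \<times> ('a, 'e) tvec) set" where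
  "zero_section A = {(p, v). p \<in> carrier_of A \<and> v = (\<lambda>c. 0)}"

section \<open>Bilinear forms, (pseudo) Riemannian and (pseudo) Kaehler metrics\<close>

type_synonym ('a, 'e) bifield = "'a \<Rightarrow> ('a, 'e) tvec \<Rightarrow> ('a, 'e) tvec \<Rightarrow> real"

definition bilinear_on ::
    "('a, 'e::euclidean_space) tvec set \<Rightarrow> (('a, 'e) tvec \<Rightarrow> ('a, 'e) tvec \<Rightarrow> real) \<Rightarrow> bool" where
  "bilinear_on V B \<longleftrightarrow>
     (\<forall>u\<in>V. \<forall>v\<in>V. \<forall>w\<in>V. \<forall>a b.
        B (lincomb a u b v) w = a * B u w + b * B v w \<and>
        B w (lincomb a u b v) = a * B w u + b * B w v)"

definition nondegenerate_on ::
    "('a, 'e::euclidean_space) tvec set \<Rightarrow> (('a, 'e) tvec \<Rightarrow> ('a, 'e) tvec \<Rightarrow> real) \<Rightarrow> bool" where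
  "nondegenerate_on V B \<longleftrightarrow> (\<forall>v\<in>V. (\<forall>w\<in>V. B v w = 0) \<longrightarrow> v = (\<lambda>c. 0))"

(* B evaluated on the vector fields with constant components a and b in the chart c, as a
   function of the coordinates u. *)
definition local_rep ::
    "('a, 'e::euclidean_space) chart set \<Rightarrow> ('a, 'e) bifield \<Rightarrow> ('a, 'e) chart \<Rightarrow>
     'e \<Rightarrow> 'e \<Rightarrow> 'e \<Rightarrow> real" where
  "local_rep A B c a b u =
     B (cinv c u) (tvec_of A c (cinv c u) a) (tvec_of A c (cinv c u) b)"

definition pseudo_riemannian ::
    "('a, 'e::euclidean_space) chart set \<Rightarrow> ('a, 'e) bifield \<Rightarrow> bool" where
  "pseudo_riemannian A g \<longleftrightarrow>
     (\<forall>p\<in>carrier_of A.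
        bilinear_on (tangent_space A p) (g p) \<and>
        (\<forall>v\<in>tangent_space A p. \<forall>w\<in>tangent_space A p. g p v w = g p w v) \<and>
        nondegenerate_on (tangent_space A p) (g p)) \<and>
     (\<forall>c\<in>A. \<forall>a b. smooth_on (snd c ` fst c) (local_rep A g c a b))"

(* The exterior derivative vanishes: in each chart,
   d omega (a, b, e) = a omega(b, e) - b omega(a, e) + e omega(a, b)
   for vector fields a, b, e with constant components. *)
definition closed_2form ::
    "('a, 'e::euclidean_space) chart set \<Rightarrow> ('a, 'e) bifield \<Rightarrow> bool" where
  "closed_2form A \<omega> \<longleftrightarrow>
     (\<forall>c\<in>A. \<forall>u \<in> snd c ` fst c. \<forall>a b e.
        frechet_derivative (local_rep A \<omega> c b e) (at u) a
        - frechet_derivative (local_rep A \<omega> c a e) (at u) b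
        + frechet_derivative (local_rep A \<omega> c a b) (at u) e = 0)"

(* An (integrable) complex structure: around each point there is a compatible chart in which J is
   a constant linear map K. Necessarily K o K = - id, so K is linearly conjugate to
   multiplication by the imaginary unit and the chart yields holomorphic coordinates. *)
definition complex_structure ::
    "('a, 'e::euclidean_space) chart set \<Rightarrow> ('a \<Rightarrow> ('a, 'e) tvec \<Rightarrow> ('a, 'e) tvec) \<Rightarrow> bool" where
  "complex_structure A J \<longleftrightarrow>
     (\<forall>p\<in>carrier_of A. \<forall>v\<in>tangent_space A p.
        J p v \<in> tangent_space A p \<and> J p (J p v) = (\<lambda>c. - v c)) \<and>
     (\<forall>p\<in>carrier_of A. \<exists>c K.
        smooth_atlas (insert c A) \<and> p \<in> fst c \<and> fst c \<subseteq> carrier_of A \<and> linear K \<and>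
        (\<forall>q\<in>fst c. \<forall>d\<in>A. q \<in> fst d \<longrightarrow> (\<forall>v\<in>tangent_space A q.
           frechet_derivative (snd c \<circ> cinv d) (at (snd d q)) (J q v d)
           = K (frechet_derivative (snd c \<circ> cinv d) (at (snd d q)) (v d)))))"

definition pseudo_kaehler ::
    "('a, 'e::euclidean_space) chart set \<Rightarrow> ('a \<Rightarrow> ('a, 'e) tvec \<Rightarrow> ('a, 'e) tvec) \<Rightarrow>
     ('a, 'e) bifield \<Rightarrow> bool" where
  "pseudo_kaehler A J g \<longleftrightarrow>
     complex_structure A J \<and> pseudo_riemannian A g \<and>
     (\<forall>p\<in>carrier_of A. \<forall>v\<in>tangent_space A p. \<forall>w\<in>tangent_space A p.
        g p (J p v) (J p w) = g p v w) \<and>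
     closed_2form A (\<lambda>p v w. g p (J p v) w)"

section \<open>Tangent metrics on the tangent manifold\<close>

(* Points of the tangent manifold and of the vertical tangent manifold of M. *)
type_synonym ('a, 'm) tpt = "'a \<times> ('a, real^'m) tvec"
type_synonym ('a, 'm) vpt = "('a, 'm) tpt \<times> (('a, 'm) tpt, (real^'m) \<times> (real^'m)) tvec"

type_synonym ('a, 'm) metric_TM = "(('a, 'm) tpt, (real^'m) \<times> (real^'m)) bifield"
type_synonym ('a, 'm) metric_TV = "(('a, 'm) vpt, (real^'m) \<times> (real^'m) \<times> (real^'m)) bifield"

definition vertical ::
    "('a, real^'m::finite) chart set \<Rightarrow> ('a, 'm) tpt \<Rightarrow>
     (('a, 'm) tpt, (real^'m) \<times> (real^'m)) tvec set" where
  "vertical A \<xi> =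
     {w \<in> tangent_space (tangent_atlas A) \<xi>. tangent_map (tangent_atlas A) A fst \<xi> w = (\<lambda>c. 0)}"

(* S (d/dx) = d/dy, S (d/dy) = 0 in each chart (x, y). *)
definition tangent_structure ::
    "(('a, 'm) tpt, (real^'m::finite) \<times> (real^'m)) tvec \<Rightarrow>
     (('a, 'm) tpt, (real^'m) \<times> (real^'m)) tvec" where
  "tangent_structure w = (\<lambda>C. (0, fst (w C)))"

definition horizontal ::
    "('a, real^'m::finite) chart set \<Rightarrow> ('a, 'm) metric_TM \<Rightarrow> ('a, 'm) tpt \<Rightarrow>
     (('a, 'm) tpt, (real^'m) \<times> (real^'m)) tvec set" where
  "horizontal A \<gamma> \<xi> =
     {X \<in> tangent_space (tangent_atlas A) \<xi>. \<forall>w\<in>vertical A \<xi>. \<gamma> \<xi> X w = 0}"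

definition tangent_metric ::
    "('a, real^'m::finite) chart set \<Rightarrow> ('a, 'm) metric_TM \<Rightarrow> bool" where
  "tangent_metric A \<gamma> \<longleftrightarrow>
     pseudo_riemannian (tangent_atlas A) \<gamma> \<and>
     (\<forall>\<xi>\<in>tangent_bundle A.
        nondegenerate_on (vertical A \<xi>) (\<gamma> \<xi>) \<and>
        (\<forall>X\<in>horizontal A \<gamma> \<xi>. \<forall>X'\<in>horizontal A \<gamma> \<xi>.
           \<gamma> \<xi> (tangent_structure X) (tangent_structure X') = \<gamma> \<xi> X X'))"

(* X_i = d/dx^i - t_i^j d/dy^j, the horizontal vector projecting to d/dx^i. *)
definition hlift ::
    "('a, real^'m::finite) chart set \<Rightarrow> ('a, 'm) metric_TM \<Rightarrow> ('a, real^'m) chart \<Rightarrow> 'm \<Rightarrow>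
     ('a, 'm) tpt \<Rightarrow> (('a, 'm) tpt, (real^'m) \<times> (real^'m)) tvec" where
  "hlift A \<gamma> c i \<xi> =
     (THE X. X \<in> horizontal A \<gamma> \<xi> \<and> fst (X (tangent_chart A c)) = axis i 1)"

definition gcomp ::
    "('a, real^'m::finite) chart set \<Rightarrow> ('a, 'm) metric_TM \<Rightarrow> ('a, real^'m) chart \<Rightarrow>
     'm \<Rightarrow> 'm \<Rightarrow> ('a, 'm) tpt \<Rightarrow> real" where
  "gcomp A \<gamma> c i j \<xi> = \<gamma> \<xi> (hlift A \<gamma> c i \<xi>) (hlift A \<gamma> c j \<xi>)"

(* The second partial derivative of L with respect to y^i and y^j in the coordinates (x, y). *)
definition fibre_hessian ::
    "('a, real^'m::finite) chart set \<Rightarrow> (('a, 'm) tpt \<Rightarrow> real) \<Rightarrow> ('a, real^'m) chart \<Rightarrow>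
     'm \<Rightarrow> 'm \<Rightarrow> ('a, 'm) tpt \<Rightarrow> real" where
  "fibre_hessian A L c i j \<xi> =
     (let C = tangent_chart A c in
      frechet_derivative
        (\<lambda>u. frechet_derivative (L \<circ> cinv C) (at u) (0, axis j 1))
        (at (snd C \<xi>)) (0, axis i 1))"

(* As L need only be continuous along the zero section, the Hessian condition is imposed off it. *)
definition lagrange_on ::
    "('a, real^'m::finite) chart set \<Rightarrow> ('a, 'm) metric_TM \<Rightarrow> ('a, 'm) tpt set \<Rightarrow>
     (('a, 'm) tpt \<Rightarrow> real) \<Rightarrow> bool" where
  "lagrange_on A \<gamma> W L \<longleftrightarrow>
     continuous_map (subtopology (atlas_topology (tangent_atlas A)) W) euclideanreal L \<and>
     smooth_function_on (tangent_atlas A) (W - zero_section A) L \<and>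
     (\<forall>\<xi> \<in> W - zero_section A. \<forall>c\<in>A. fst \<xi> \<in> fst c \<longrightarrow>
        (\<forall>i j. gcomp A \<gamma> c i j \<xi> = fibre_hessian A L c i j \<xi>))"

definition locally_lagrange ::
    "('a, real^'m::finite) chart set \<Rightarrow> ('a, 'm) metric_TM \<Rightarrow> bool" where
  "locally_lagrange A \<gamma> \<longleftrightarrow>
     (\<forall>\<xi>\<in>tangent_bundle A. \<exists>W L.
        openin (atlas_topology (tangent_atlas A)) W \<and> \<xi> \<in> W \<and> lagrange_on A \<gamma> W L)"

section \<open>The vertical tangent manifold and the double vertical foliation\<close>

(* The tangent bundle of the vertical leaves: pairs of a point of TM and a vertical vector there. *)
definition vertical_bundle :: "('a, real^'m::finite) chart set \<Rightarrow> ('a, 'm) vpt set" where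
  "vertical_bundle A = {(\<xi>, w). \<xi> \<in> tangent_bundle A \<and> w \<in> vertical A \<xi>}"

(* The local coordinates (x, y, eta). *)
definition vertical_chart ::
    "('a, real^'m::finite) chart set \<Rightarrow> ('a, real^'m) chart \<Rightarrow>
     (('a, 'm) vpt, (real^'m) \<times> (real^'m) \<times> (real^'m)) chart" where
  "vertical_chart A c =
     ({Z \<in> vertical_bundle A. fst (fst Z) \<in> fst c},
      \<lambda>Z. (snd c (fst (fst Z)), snd (fst Z) c, snd (snd Z (tangent_chart A c))))"

definition vertical_atlas ::
    "('a, real^'m::finite) chart set \<Rightarrow>
     (('a, 'm) vpt, (real^'m) \<times> (real^'m) \<times> (real^'m)) chart set" where
  "vertical_atlas A = vertical_chart A ` A"

definition vproj :: "('a, 'm::finite) vpt \<Rightarrow> 'a" where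
  "vproj Z = fst (fst Z)"

definition double_vertical ::
    "('a, real^'m::finite) chart set \<Rightarrow> ('a, 'm) vpt \<Rightarrow>
     (('a, 'm) vpt, (real^'m) \<times> (real^'m) \<times> (real^'m)) tvec set" where
  "double_vertical A Z =
     {w \<in> tangent_space (vertical_atlas A) Z. tangent_map (vertical_atlas A) A vproj Z w = (\<lambda>c. 0)}"

definition d_dy ::
    "('a, real^'m::finite) chart set \<Rightarrow> ('a, real^'m) chart \<Rightarrow> 'm \<Rightarrow> ('a, 'm) vpt \<Rightarrow>
     (('a, 'm) vpt, (real^'m) \<times> (real^'m) \<times> (real^'m)) tvec" where
  "d_dy A c i Z = tvec_of (vertical_atlas A) (vertical_chart A c) Z (0, axis i 1, 0)"

definition d_deta ::
    "('a, real^'m::finite) chart set \<Rightarrow> ('a, real^'m) chart \<Rightarrow> 'm \<Rightarrow> ('a, 'm) vpt \<Rightarrow>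
     (('a, 'm) vpt, (real^'m) \<times> (real^'m) \<times> (real^'m)) tvec" where
  "d_deta A c i Z = tvec_of (vertical_atlas A) (vertical_chart A c) Z (0, 0, axis i 1)"

(* G is an extension of gamma: the foliations V_1 = span (d/dy) and V_2 = span (d/d eta) are
   orthogonal and both carry the components g_ij(x, y), and the orthogonal complement of
   V_1 + V_2 with G is identified with (H, gamma|H), vectors with the same projection to M
   corresponding to each other. *)
definition is_extension ::
    "('a, real^'m::finite) chart set \<Rightarrow> ('a, 'm) metric_TM \<Rightarrow> ('a, 'm) metric_TV \<Rightarrow> bool" where
  "is_extension A \<gamma> G \<longleftrightarrow>
     pseudo_riemannian (vertical_atlas A) G \<and>
     (\<forall>Z\<in>vertical_bundle A. \<forall>c\<in>A. vproj Z \<in> fst c \<longrightarrow>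
        (\<forall>i j.
           G Z (d_dy A c i Z) (d_dy A c j Z) = gcomp A \<gamma> c i j (fst Z) \<and>
           G Z (d_deta A c i Z) (d_deta A c j Z) = gcomp A \<gamma> c i j (fst Z) \<and>
           G Z (d_dy A c i Z) (d_deta A c j Z) = 0)) \<and>
     (\<forall>Z\<in>vertical_bundle A.
        let N = {X \<in> tangent_space (vertical_atlas A) Z. \<forall>w\<in>double_vertical A Z. G Z X w = 0};
            dp = tangent_map (vertical_atlas A) A vproj Z;
            dpi = tangent_map (tangent_atlas A) A fst (fst Z)
        in \<forall>X\<in>N. \<forall>X'\<in>N. \<forall>Y\<in>horizontal A \<gamma> (fst Z). \<forall>Y'\<in>horizontal A \<gamma> (fst Z).
             dp X = dpi Y \<and> dp X' = dpi Y' \<longrightarrow> G Z X X' = \<gamma> (fst Z) Y Y')"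

definition leaf :: "('a, real^'m::finite) chart set \<Rightarrow> 'a \<Rightarrow> ('a, 'm) vpt set" where
  "leaf A q = {Z \<in> vertical_bundle A. vproj Z = q}"

(* The coordinates (y, eta) on the leaf over q. *)
definition leaf_chart ::
    "('a, real^'m::finite) chart set \<Rightarrow> 'a \<Rightarrow> ('a, real^'m) chart \<Rightarrow>
     (('a, 'm) vpt, (real^'m) \<times> (real^'m)) chart" where
  "leaf_chart A q c = (leaf A q, \<lambda>Z. (snd (fst Z) c, snd (snd Z (tangent_chart A c))))"

definition leaf_atlas ::
    "('a, real^'m::finite) chart set \<Rightarrow> 'a \<Rightarrow> (('a, 'm) vpt, (real^'m) \<times> (real^'m)) chart set" where
  "leaf_atlas A q = leaf_chart A q ` {c \<in> A. q \<in> fst c}"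

(* J (d/dy) = d/d eta, J (d/d eta) = - d/dy in each chart (y, eta). *)
definition leaf_J ::
    "('a, 'm) vpt \<Rightarrow> (('a, 'm) vpt, (real^'m::finite) \<times> (real^'m)) tvec \<Rightarrow>
     (('a, 'm) vpt, (real^'m) \<times> (real^'m)) tvec" where
  "leaf_J Z w = (\<lambda>C. (- snd (w C), fst (w C)))"

(* Restriction of G to the leaf over q, i.e. the pull-back by the inclusion map. *)
definition leaf_metric ::
    "('a, real^'m::finite) chart set \<Rightarrow> 'a \<Rightarrow> ('a, 'm) metric_TV \<Rightarrow>
     (('a, 'm) vpt, (real^'m) \<times> (real^'m)) bifield" where
  "leaf_metric A q G Z v w =
     G Z (tangent_map (leaf_atlas A q) (vertical_atlas A) (\<lambda>Z. Z) Z v)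
         (tangent_map (leaf_atlas A q) (vertical_atlas A) (\<lambda>Z. Z) Z w)"

end

theory Submission
  imports Defs
begin

text \<open>
  On a leaf of the double vertical foliation the metric is \<open>g\<^sub>i\<^sub>j(x,y)(dy\<^sup>idy\<^sup>j + d\<eta>\<^sup>id\<eta>\<^sup>j)\<close>, and its
  Kaehler form \<open>g\<^sub>i\<^sub>j dy\<^sup>i \<and> d\<eta>\<^sup>j\<close> is closed iff \<open>\<partial>g\<^sub>i\<^sub>j/\<partial>y\<^sup>k\<close> is symmetric in all its indices.
  A fibre Hessian has this symmetry off the zero section by Schwarz, and on it by continuity.
  Conversely, since the fibres are star-shaped, the Poincare lemma applied twice along the
  fibres, with \<open>x\<close> as a parameter, writes \<open>g\<^sub>i\<^sub>j\<close> as the Hessian of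
  \<open>\<integral>\<^sub>0\<^sup>1\<integral>\<^sub>0\<^sup>1 s g\<^sub>i\<^sub>j(x,tsy) y\<^sup>iy\<^sup>j dt ds\<close>. This expression does not depend on the chart, so the Lagrangian is even
  defined on the whole tangent manifold.
\<close>

section \<open>Calculus of smooth functions\<close>

text \<open>The horizontal bundle leaves the argument early: the condition \<gamma>(SX, SX') =
  \<gamma>(X, X') carries the components \<open>g_ij\<close>, defined on horizontal lifts, over to
  the vertical vectors d/dy. Both sides of the equivalence then become one condition on the fibres,
  \<open>fibre_symmetric\<close>. On vertical vectors every coordinate change acts through the
  Jacobian of the base alone; hence \<open>leaf_J\<close> is well defined and the integral formula
  is independent of the chart. The zero section separates the two directions. A given Lagrangian is
  smooth only off it, whereas \<gamma> is smooth across it, so the first derivatives of g, not the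
  third derivatives of L, are what is continued to y = 0. In the converse, smoothness is required
  jointly in (x, y), so integrals along rays must be differentiated under the sign to every order. A
  fibre derivative at t y brings out a factor t; the integrals therefore carry an arbitrary
  continuous weight, which makes their class stable under differentiation. The factor s in the
  double integral appears because the first potential, itself linear in an explicit factor y, is
  evaluated at s y.\<close>

lemma Ck_on_cong:
  assumes "open S" "Ck_on k S f" "\<And>x. x \<in> S \<Longrightarrow> f x = g x"
  shows "Ck_on k S g"
  using assms(2,3)
proof (induction k arbitrary: f g)
  case 0
  then show ?case by (simp cong: continuous_on_cong)
next
  case (Suc k)
  have d: "(g has_derivative frechet_derivative f (at x)) (at x)" if "x \<in> S" for x
    using Suc.prems that assms(1)
    by (metis Ck_on.simps(2) frechet_derivative_works has_derivative_transform_within_open)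
  have "Ck_on k S (\<lambda>x. frechet_derivative g (at x) v)" for v
  proof (rule Suc.IH)
    show "Ck_on k S (\<lambda>x. frechet_derivative f (at x) v)" using Suc.prems(1) by simp
    show "frechet_derivative f (at x) v = frechet_derivative g (at x) v" if "x \<in> S" for x
      by (rule fun_cong[OF frechet_derivative_at[OF d[OF that]]])
  qed
  with d show ?case unfolding Ck_on.simps differentiable_def by blast
qed

text \<open>\<open>frechet_derivative\<close> is a choice operator; uniqueness of derivatives lets
  the inductions below work with an explicit formula \<open>f'\<close> in its place.\<close>

lemma Ck_on_SucI:
  assumes "open S" "\<And>x. x \<in> S \<Longrightarrow> (f has_derivative f' x) (at x)"
    and "\<And>v. Ck_on k S (\<lambda>x. f' x v)"
  shows "Ck_on (Suc k) S f"
proof -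
  have "Ck_on k S (\<lambda>x. frechet_derivative f (at x) v)" for v
    using frechet_derivative_at[OF assms(2)] by (intro Ck_on_cong[OF assms(1) assms(3)[of v]]) auto
  with assms(2) show ?thesis unfolding Ck_on.simps differentiable_def by blast
qed

lemma Ck_on_SucD: "Ck_on (Suc k) S f \<Longrightarrow> Ck_on k S f"
proof (induction k arbitrary: f)
  case 0
  then show ?case
    by (metis Ck_on.simps continuous_at_imp_continuous_on differentiable_imp_continuous_within)
next
  case (Suc k)
  then show ?case by (metis Ck_on.simps(2))
qed

lemma Ck_on_subset: "Ck_on k S f \<Longrightarrow> T \<subseteq> S \<Longrightarrow> Ck_on k T f"
  by (induction k arbitrary: f) (auto intro: continuous_on_subset)

lemma Ck_on_has_derivative:
  "Ck_on (Suc k) S f \<Longrightarrow> x \<in> S \<Longrightarrow> (f has_derivative frechet_derivative f (at x)) (at x)"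
  by (simp add: frechet_derivative_works)

lemma Ck_on_const: "Ck_on k S (\<lambda>x. c)"
proof (induction k arbitrary: c)
  case (Suc k)
  then show ?case by simp
qed simp

lemma Ck_on_linear:
  assumes "bounded_linear f"
  shows "Ck_on k S f"
proof (cases k)
  case 0
  then show ?thesis using assms by (simp add: linear_continuous_on)
next
  case (Suc j)
  have "frechet_derivative f (at x) = f" for x
    using assms bounded_linear_imp_has_derivative frechet_derivative_at by metis
  then show ?thesis
    using Suc assms by (auto intro: Ck_on_const bounded_linear_imp_differentiable)
qed

lemma Ck_on_derivative: "Ck_on (Suc k) S f \<Longrightarrow> Ck_on k S (\<lambda>x. frechet_derivative f (at x) v)"
  by simp

lemma Ck_on_add:
  assumes "open S" "Ck_on k S f" "Ck_on k S g"
  shows "Ck_on k S (\<lambda>x. f x + g x)"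
  using assms(2,3)
proof (induction k arbitrary: f g)
  case (Suc k)
  show ?case
  proof (rule Ck_on_SucI[OF assms(1)])
    show "((\<lambda>x. f x + g x) has_derivative
        (\<lambda>v. frechet_derivative f (at x) v + frechet_derivative g (at x) v)) (at x)" if "x \<in> S" for x
      by (rule has_derivative_add[OF Suc.prems[THEN Ck_on_has_derivative, OF that]])
    show "Ck_on k S (\<lambda>x. frechet_derivative f (at x) v + frechet_derivative g (at x) v)" for v
      by (rule Suc.IH[OF Suc.prems[THEN Ck_on_derivative]])
  qed
qed (auto intro: continuous_on_add)

lemma Ck_on_sum:
  assumes "open S" "\<And>i. i \<in> I \<Longrightarrow> Ck_on k S (f i)"
  shows "Ck_on k S (\<lambda>x. \<Sum>i\<in>I. f i x)"
  using assms(2)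
  by (induction I rule: infinite_finite_induct) (auto intro: Ck_on_const Ck_on_add[OF assms(1)])

text \<open>By the product rule the derivative is a sum of two terms of the same form: one factor is
  differentiated, the other merely gives up one order. Hence the induction has to range over both
  functions.\<close>

lemma Ck_on_bilinear:
  assumes "bounded_bilinear h" "open S" "Ck_on k S f" "Ck_on k S g"
  shows "Ck_on k S (\<lambda>x. h (f x) (g x))"
  using assms(3,4)
proof (induction k arbitrary: f g)
  case 0
  then show ?case by (simp add: bounded_bilinear.continuous_on[OF assms(1)])
next
  case (Suc k)
  show ?case
  proof (rule Ck_on_SucI[OF assms(2)])
    show "((\<lambda>x. h (f x) (g x)) has_derivative (\<lambda>v. h (f x) (frechet_derivative g (at x) v)
        + h (frechet_derivative f (at x) v) (g x))) (at x)" if "x \<in> S" for x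
      by (rule bounded_bilinear.FDERIV[OF assms(1) Suc.prems[THEN Ck_on_has_derivative, OF that]])
    show "Ck_on k S (\<lambda>x. h (f x) (frechet_derivative g (at x) v)
        + h (frechet_derivative f (at x) v) (g x))" for v
      by (rule Ck_on_add[OF assms(2) Suc.IH[OF Suc.prems(1)[THEN Ck_on_SucD] Suc.prems(2)[THEN Ck_on_derivative]]
            Suc.IH[OF Suc.prems(1)[THEN Ck_on_derivative] Suc.prems(2)[THEN Ck_on_SucD]]])
  qed
qed

text \<open>The inner map has the constant derivative \<open>L\<close>, so a directional derivative
  of the composite is a directional derivative of \<open>f\<close> composed with the same affine
  map, and the induction closes.\<close>

lemma Ck_on_affine_comp:
  assumes "bounded_linear L" "open S" "\<And>x. x \<in> S \<Longrightarrow> c + L x \<in> T" "Ck_on k T f"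
  shows "Ck_on k S (\<lambda>x. f (c + L x))"
  using assms(4)
proof (induction k arbitrary: f)
  case 0
  have "continuous_on S (\<lambda>x. c + L x)"
    using assms(1) by (intro continuous_intros linear_continuous_on)
  then show ?case
    using 0 assms(3) by (auto intro: continuous_on_compose2[of T f S])
next
  case (Suc k)
  have L: "((\<lambda>x. c + L x) has_derivative L) (at x)" for x
    by (auto intro!: derivative_eq_intros bounded_linear_imp_has_derivative assms(1))
  show ?case
  proof (rule Ck_on_SucI[OF assms(2)])
    show "((\<lambda>x. f (c + L x)) has_derivative (\<lambda>v. frechet_derivative f (at (c + L x)) (L v))) (at x)"
      if "x \<in> S" for x
      by (rule has_derivative_compose[OF L Ck_on_has_derivative[OF Suc.prems assms(3)[OF that]]])
    show "Ck_on k S (\<lambda>x. frechet_derivative f (at (c + L x)) (L v))" for v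
      by (rule Suc.IH[OF Suc.prems[THEN Ck_on_derivative]])
  qed
qed

lemma Ck_on_linear_comp:
  assumes "bounded_linear L" "open S" "Ck_on k S f"
  shows "Ck_on k S (\<lambda>x. L (f x))"
  using assms(3)
proof (induction k arbitrary: f)
  case 0
  then show ?case using assms(1) by (simp add: bounded_linear.continuous_on)
next
  case (Suc k)
  show ?case
  proof (rule Ck_on_SucI[OF assms(2)])
    show "((\<lambda>x. L (f x)) has_derivative (\<lambda>v. L (frechet_derivative f (at x) v))) (at x)"
      if "x \<in> S" for x
      by (rule bounded_linear.has_derivative[OF assms(1) Ck_on_has_derivative[OF Suc.prems that]])
    show "Ck_on k S (\<lambda>x. L (frechet_derivative f (at x) v))" for v
      by (rule Suc.IH[OF Suc.prems[THEN Ck_on_derivative]])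
  qed
qed

lemma smooth_on_has_derivative:
  "smooth_on S f \<Longrightarrow> x \<in> S \<Longrightarrow> (f has_derivative frechet_derivative f (at x)) (at x)"
  unfolding smooth_on_def using Ck_on_has_derivative by blast

lemma smooth_on_derivative: "smooth_on S f \<Longrightarrow> smooth_on S (\<lambda>x. frechet_derivative f (at x) v)"
  unfolding smooth_on_def by (metis Ck_on.simps(2))

lemma smooth_on_imp_continuous_on: "smooth_on S f \<Longrightarrow> continuous_on S f"
  unfolding smooth_on_def by (metis Ck_on.simps(1))

lemma smooth_on_cong:
  "open S \<Longrightarrow> smooth_on S f \<Longrightarrow> (\<And>x. x \<in> S \<Longrightarrow> f x = g x) \<Longrightarrow> smooth_on S g"
  unfolding smooth_on_def using Ck_on_cong by blast

lemma smooth_on_subset: "smooth_on S f \<Longrightarrow> T \<subseteq> S \<Longrightarrow> smooth_on T f"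
  unfolding smooth_on_def using Ck_on_subset by blast

lemma smooth_on_linear: "bounded_linear f \<Longrightarrow> smooth_on S f"
  unfolding smooth_on_def using Ck_on_linear by blast

lemma smooth_on_add:
  "open S \<Longrightarrow> smooth_on S f \<Longrightarrow> smooth_on S g \<Longrightarrow> smooth_on S (\<lambda>x. f x + g x)"
  unfolding smooth_on_def using Ck_on_add by blast

lemma smooth_on_sum:
  "open S \<Longrightarrow> (\<And>i. i \<in> I \<Longrightarrow> smooth_on S (f i)) \<Longrightarrow> smooth_on S (\<lambda>x. \<Sum>i\<in>I. f i x)"
  unfolding smooth_on_def by (simp add: Ck_on_sum)

lemma smooth_on_bilinear:
  "bounded_bilinear h \<Longrightarrow> open S \<Longrightarrow> smooth_on S f \<Longrightarrow> smooth_on S g \<Longrightarrow>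
    smooth_on S (\<lambda>x. h (f x) (g x))"
  unfolding smooth_on_def using Ck_on_bilinear by blast

lemma smooth_on_affine_comp:
  assumes "bounded_linear L" "open S" "\<And>x. x \<in> S \<Longrightarrow> c + L x \<in> T" "smooth_on T f"
  shows "smooth_on S (\<lambda>x. f (c + L x))"
  using assms Ck_on_affine_comp[of L S c T] unfolding smooth_on_def by blast

lemma smooth_on_linear_comp:
  "bounded_linear L \<Longrightarrow> open S \<Longrightarrow> smooth_on S f \<Longrightarrow> smooth_on S (\<lambda>x. L (f x))"
  unfolding smooth_on_def using Ck_on_linear_comp by blast

lemma smooth_on_Pair:
  assumes "open S" "smooth_on S f" "smooth_on S g"
  shows "smooth_on S (\<lambda>x. (f x, g x))"
proof -
  have 1: "bounded_linear (\<lambda>a. (a, 0))" and 2: "bounded_linear (\<lambda>b. (0, b))"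
    by (intro bounded_linear_Pair bounded_linear_ident bounded_linear_zero)+
  have "smooth_on S (\<lambda>x. (f x, 0) + (0, g x))"
    by (intro smooth_on_add smooth_on_linear_comp[OF 1] smooth_on_linear_comp[OF 2] assms)
  then show ?thesis by simp
qed

section \<open>Symmetry of second derivatives\<close>

lemma has_real_derivative_along_line:
  fixes f :: "'e::real_normed_vector \<Rightarrow> real"
  assumes "(f has_derivative f') (at (p + s *\<^sub>R a))"
  shows "((\<lambda>s. f (p + s *\<^sub>R a)) has_real_derivative f' a) (at s)"
proof -
  have "((\<lambda>s. p + s *\<^sub>R a) has_derivative (\<lambda>r. r *\<^sub>R a)) (at s)"
    by (auto intro!: derivative_eq_intros)
  from has_derivative_compose[OF this assms]
  have "((\<lambda>s. f (p + s *\<^sub>R a)) has_derivative (\<lambda>r. f' (r *\<^sub>R a))) (at s)" .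
  moreover have "(\<lambda>r. f' (r *\<^sub>R a)) = (*) (f' a)"
    using linear_cmul[OF has_derivative_linear[OF assms]] by (simp add: fun_eq_iff)
  ultimately show ?thesis by (simp add: has_field_derivative_def)
qed

text \<open>The second difference is the increment of \<open>?\<phi>\<close> over [0, r]. The mean
  value theorem for \<open>?\<phi>\<close> produces s, and a second application in the direction b
  produces t. The left-hand side does not change when a and b are exchanged, although the derivative
  on the right does; Schwarz' theorem rests on this.\<close>

lemma second_difference_mean_value:
  fixes f :: "'e::euclidean_space \<Rightarrow> real"
  assumes "Ck_on 2 S f" "0 < r"
    and S: "\<And>s t. s \<in> {0..r} \<Longrightarrow> t \<in> {0..r} \<Longrightarrow> x + s *\<^sub>R a + t *\<^sub>R b \<in> S"
  shows "\<exists>s\<in>{0..r}. \<exists>t\<in>{0..r}.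
    f (x + r *\<^sub>R a + r *\<^sub>R b) - f (x + r *\<^sub>R a) - f (x + r *\<^sub>R b) + f x =
    r * r * frechet_derivative (\<lambda>u. frechet_derivative f (at u) a) (at (x + s *\<^sub>R a + t *\<^sub>R b)) b"
proof -
  have f: "(f has_derivative frechet_derivative f (at u)) (at u)"
    and fa: "((\<lambda>u. frechet_derivative f (at u) a) has_derivative
       frechet_derivative (\<lambda>u. frechet_derivative f (at u) a) (at u)) (at u)" if "u \<in> S" for u
    using assms(1) that by (auto simp: numeral_2_eq_2 frechet_derivative_works)
  let ?\<phi> = "\<lambda>s. f ((x + r *\<^sub>R b) + s *\<^sub>R a) - f (x + s *\<^sub>R a)"
  have d1: "(?\<phi> has_real_derivative (frechet_derivative f (at ((x + r *\<^sub>R b) + s *\<^sub>R a)) a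
      - frechet_derivative f (at (x + s *\<^sub>R a)) a)) (at s)" if "0 \<le> s" "s \<le> r" for s
    using S[of s r] S[of s 0] that assms(2)
    by (intro DERIV_diff has_real_derivative_along_line f) (auto simp: add_ac)
  obtain s where s: "0 < s" "s < r" and e1: "?\<phi> r - ?\<phi> 0 = (r - 0) *
      (frechet_derivative f (at ((x + r *\<^sub>R b) + s *\<^sub>R a)) a
      - frechet_derivative f (at (x + s *\<^sub>R a)) a)"
    using MVT2[OF assms(2) d1] by blast
  let ?\<psi> = "\<lambda>t. frechet_derivative f (at ((x + s *\<^sub>R a) + t *\<^sub>R b)) a"
  have d2: "(?\<psi> has_real_derivative
      frechet_derivative (\<lambda>u. frechet_derivative f (at u) a) (at ((x + s *\<^sub>R a) + t *\<^sub>R b)) b) (at t)"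
    if "0 \<le> t" "t \<le> r" for t
    using S[of s t] that s
    by (intro has_real_derivative_along_line[of "\<lambda>u. frechet_derivative f (at u) a"] fa) auto
  obtain t where t: "0 < t" "t < r" and e2: "?\<psi> r - ?\<psi> 0 = (r - 0) *
      frechet_derivative (\<lambda>u. frechet_derivative f (at u) a) (at ((x + s *\<^sub>R a) + t *\<^sub>R b)) b"
    using MVT2[OF assms(2) d2] by blast
  from e1 e2 have "f (x + r *\<^sub>R a + r *\<^sub>R b) - f (x + r *\<^sub>R a) - f (x + r *\<^sub>R b) + f x =
    r * r * frechet_derivative (\<lambda>u. frechet_derivative f (at u) a) (at (x + s *\<^sub>R a + t *\<^sub>R b)) b"
    by (simp add: algebra_simps)
  with s t show ?thesis by (meson atLeastAtMost_iff less_imp_le)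
qed

lemma second_derivative_symmetric:
  fixes f :: "'e::euclidean_space \<Rightarrow> real"
  assumes "open S" "Ck_on 2 S f" "x \<in> S"
  shows "frechet_derivative (\<lambda>u. frechet_derivative f (at u) a) (at x) b =
    frechet_derivative (\<lambda>u. frechet_derivative f (at u) b) (at x) a"
proof (rule ccontr)
  let ?D = "\<lambda>a b u. frechet_derivative (\<lambda>u. frechet_derivative f (at u) a) (at u) b"
  assume ne: "?D a b x \<noteq> ?D b a x"
  \<comment> \<open>Half of the assumed gap: no single number lies within \<open>e\<close> of both
    second derivatives, which is the contradiction reached at the end.\<close>
  define e where "e = \<bar>?D a b x - ?D b a x\<bar> / 2"
  have e: "e > 0" using ne by (simp add: e_def)
  have "continuous_on S (?D a b)" for a b using assms(2) by (simp add: numeral_2_eq_2)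
  then have "(?D a b \<longlongrightarrow> ?D a b x) (nhds x)" for a b
    using assms(1,3) continuous_on_eq_continuous_at[OF assms(1)] isCont_def tendsto_at_iff_tendsto_nhds
    by blast
  then have ev: "\<forall>\<^sub>F u in nhds x. \<bar>?D a b u - ?D a b x\<bar> < e" for a b
    unfolding dist_real_def[symmetric] by (rule tendstoD[OF _ e])
  have "\<forall>\<^sub>F u in nhds x. u \<in> S \<and> \<bar>?D a b u - ?D a b x\<bar> < e \<and> \<bar>?D b a u - ?D b a x\<bar> < e"
    using eventually_nhds_in_open[OF assms(1,3)] ev by (intro eventually_conj) auto
  then obtain d where d: "d > 0" and
    dd: "\<And>u. dist u x < d \<Longrightarrow> u \<in> S \<and> \<bar>?D a b u - ?D a b x\<bar> < e \<and> \<bar>?D b a u - ?D b a x\<bar> < e"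
    unfolding eventually_nhds_metric by blast
  \<comment> \<open>The whole parallelogram with sides r a and r b has to fit into the ball of
    radius d. The summand 1 keeps the denominator positive and makes the final estimate
    strict.\<close>
  define r where "r = d / (norm a + norm b + 1)"
  have n: "norm a + norm b + 1 > 0" by (simp add: add_nonneg_pos)
  have r: "r > 0" and rd: "r * (norm a + norm b + 1) = d"
    using d n by (auto simp: r_def)
  have near: "dist (x + s *\<^sub>R a + t *\<^sub>R b) x < d" if "s \<in> {0..r}" "t \<in> {0..r}" for s t
  proof -
    have "dist (x + s *\<^sub>R a + t *\<^sub>R b) x \<le> \<bar>s\<bar> * norm a + \<bar>t\<bar> * norm b"
      using norm_triangle_ineq[of "s *\<^sub>R a" "t *\<^sub>R b"] by (simp add: dist_norm add.assoc)
    also have "\<dots> \<le> r * norm a + r * norm b"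
      using that by (intro add_mono mult_right_mono) auto
    also have "\<dots> < d" using rd r by (auto simp: algebra_simps)
    finally show ?thesis .
  qed
  obtain s t where 1: "s \<in> {0..r}" "t \<in> {0..r}"
    and e1: "f (x + r *\<^sub>R a + r *\<^sub>R b) - f (x + r *\<^sub>R a) - f (x + r *\<^sub>R b) + f x =
      r * r * ?D a b (x + s *\<^sub>R a + t *\<^sub>R b)"
    using second_difference_mean_value[OF assms(2) r] near dd by meson
  have near': "x + s *\<^sub>R b + t *\<^sub>R a \<in> S" if "s \<in> {0..r}" "t \<in> {0..r}" for s t
    using near[OF that(2,1)] dd by (simp add: add_ac)
  obtain s' t' where 2: "s' \<in> {0..r}" "t' \<in> {0..r}"
    and e2: "f (x + r *\<^sub>R b + r *\<^sub>R a) - f (x + r *\<^sub>R b) - f (x + r *\<^sub>R a) + f x =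
      r * r * ?D b a (x + s' *\<^sub>R b + t' *\<^sub>R a)"
    using second_difference_mean_value[OF assms(2) r near'] by meson
  \<comment> \<open>Both mean values express the same second difference, taken with a and b in
    either order.\<close>
  have "r * r * ?D a b (x + s *\<^sub>R a + t *\<^sub>R b) = r * r * ?D b a (x + s' *\<^sub>R b + t' *\<^sub>R a)"
    unfolding e1[symmetric] e2[symmetric] by (simp add: add_ac)
  then have "?D a b (x + s *\<^sub>R a + t *\<^sub>R b) = ?D b a (x + t' *\<^sub>R a + s' *\<^sub>R b)"
    using r by (simp add: add_ac)
  moreover have "\<bar>?D a b (x + s *\<^sub>R a + t *\<^sub>R b) - ?D a b x\<bar> < e"
    "\<bar>?D b a (x + t' *\<^sub>R a + s' *\<^sub>R b) - ?D b a x\<bar> < e"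
    using dd near 1 2 by blast+
  moreover have False if "\<bar>p - q\<bar> < e" "\<bar>p - q'\<bar> < e" "e = \<bar>q - q'\<bar> / 2" for p q q' :: real
    using that by (auto simp: abs_if split: if_splits)
  ultimately show False using e_def by metis
qed

section \<open>A fibrewise Poincare lemma\<close>

lemma linear_integral:
  fixes K :: "'f::euclidean_space \<Rightarrow> real \<Rightarrow> real"
  assumes "\<And>t. t \<in> {0..1} \<Longrightarrow> linear (\<lambda>e. K e t)" "\<And>e. continuous_on {0..1} (K e)"
  shows "linear (\<lambda>e. integral {0..1} (K e))"
proof
  have int: "K e integrable_on {0..1}" for e
    by (rule integrable_continuous_real[OF assms(2)])
  show "integral {0..1} (K (a + b)) = integral {0..1} (K a) + integral {0..1} (K b)" for a b
    unfolding integral_add[OF int int, symmetric]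
    by (rule integral_cong) (simp add: linear_add[OF assms(1)])
  show "integral {0..1} (K (r *\<^sub>R a)) = r *\<^sub>R integral {0..1} (K a)" for r a
    unfolding integral_cmul[symmetric]
    by (rule integral_cong) (use linear_cmul[OF assms(1)] in simp)
qed

lemma linear_euclidean_expansion:
  fixes f :: "'f::euclidean_space \<Rightarrow> real"
  assumes "linear f"
  shows "(\<Sum>e\<in>Basis. (y \<bullet> e) * f e) = f y"
proof -
  have "f y = f (\<Sum>e\<in>Basis. (y \<bullet> e) *\<^sub>R e)" by (simp add: euclidean_representation)
  also have "\<dots> = (\<Sum>e\<in>Basis. (y \<bullet> e) * f e)"
    by (simp add: linear_sum[OF assms] linear_cmul[OF assms])
  finally show ?thesis by simp
qed

text \<open>Integral of f along the segment from the origin of the fibre to the point. The weight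
  \<open>p\<close> is there because differentiation in a fibre direction replaces \<open>p t\<close>
  by \<open>p t * t\<close>.\<close>

definition ray_integral ::
    "(real \<Rightarrow> real) \<Rightarrow> ('e::euclidean_space \<times> 'f::euclidean_space \<Rightarrow> real) \<Rightarrow> 'e \<times> 'f \<Rightarrow> real" where
  "ray_integral p f u = integral {0..1} (\<lambda>t. p t * f (fst u, t *\<^sub>R snd u))"

lemma continuous_on_ray:
  fixes f :: "'e::euclidean_space \<times> 'f::euclidean_space \<Rightarrow> real"
  assumes "continuous_on (U \<times> UNIV) f" "x \<in> U"
  shows "continuous_on S (\<lambda>t. f (x, t *\<^sub>R y))"
  using assms(2) by (intro continuous_on_compose2[OF assms(1)] continuous_intros) auto

lemma continuous_on_ray_joint:
  fixes f :: "'e::euclidean_space \<times> 'f::euclidean_space \<Rightarrow> real"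
  assumes "continuous_on (U \<times> UNIV) f" "continuous_on {0..1} p" "S \<subseteq> U \<times> UNIV"
  shows "continuous_on (S \<times> cbox 0 1) (\<lambda>z. p (snd z) * f (fst (fst z), snd z *\<^sub>R snd (fst z)))"
  using assms(3)
  by (intro continuous_on_mult continuous_on_compose2[OF assms(1)] continuous_on_compose2[OF assms(2)]
      continuous_intros) auto

lemma continuous_on_ray_integral:
  fixes f :: "'e::euclidean_space \<times> 'f::euclidean_space \<Rightarrow> real"
  assumes "continuous_on (U \<times> UNIV) f" "continuous_on {0..1} p"
  shows "continuous_on (U \<times> UNIV) (ray_integral p f)"
proof -
  have "continuous_on (U \<times> UNIV) (\<lambda>u. integral (cbox 0 1) (\<lambda>t. p t * f (fst u, t *\<^sub>R snd u)))"
    using continuous_on_ray_joint[OF assms order_refl]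
    by (intro integral_continuous_on_param) (simp add: case_prod_beta')
  then show ?thesis by (simp add: ray_integral_def[abs_def])
qed

text \<open>Differentiation under the integral sign. The map (x, y) to (x, t y) sends a direction v
  to (fst v, t snd v); linearity splits off the fibre part, whose factor t is absorbed into the
  weight.\<close>

lemma ray_integral_has_derivative:
  fixes f :: "'e::euclidean_space \<times> 'f::euclidean_space \<Rightarrow> real"
  assumes U: "open U" and p: "continuous_on {0..1} p" and f: "Ck_on (Suc 0) (U \<times> UNIV) f"
    and u0: "u0 \<in> U \<times> UNIV"
  shows "(ray_integral p f has_derivative (\<lambda>v.
      ray_integral p (\<lambda>u. frechet_derivative f (at u) (fst v, 0)) u0 +
      ray_integral (\<lambda>t. p t * t) (\<lambda>u. frechet_derivative f (at u) (0, snd v)) u0)) (at u0)"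
proof -
  let ?S = "U \<times> (UNIV :: 'f set)"
  have S: "open ?S" using U by (simp add: open_Times)
  \<comment> \<open>The Leibniz rule asks for a convex parameter domain, and \<open>U\<close> is
    only open; a ball around \<open>u0\<close> serves.\<close>
  then obtain r where r: "r > 0" "ball u0 r \<subseteq> ?S"
    using u0 open_contains_ball by blast
  let ?B = "ball u0 r"
  let ?D = "\<lambda>u. frechet_derivative f (at u)"
  have fd: "(f has_derivative ?D u) (at u)" if "u \<in> ?S" for u
    using f that by (rule Ck_on_has_derivative)
  have cD: "continuous_on ?S (\<lambda>u. ?D u v)" for v
    using Ck_on_derivative[OF f] by (simp only: Ck_on.simps)
  have cf: "continuous_on ?S f" using Ck_on_SucD[OF f] by simp
  let ?F = "\<lambda>u t v. p t * ?D (fst u, t *\<^sub>R snd u) (fst v, t *\<^sub>R snd v)"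
  have FD: "((\<lambda>u. p t * f (fst u, t *\<^sub>R snd u)) has_derivative ?F u t) (at u)" if "u \<in> ?S" for u t
  proof -
    have "((\<lambda>u. (fst u, t *\<^sub>R snd u)) has_derivative (\<lambda>v. (fst v, t *\<^sub>R snd v))) (at u)"
      by (auto intro!: derivative_eq_intros)
    moreover have "(f has_derivative ?D (fst u, t *\<^sub>R snd u)) (at (fst u, t *\<^sub>R snd u))"
      using that by (intro fd) auto
    ultimately have "((\<lambda>u. f (fst u, t *\<^sub>R snd u)) has_derivative
        (\<lambda>v. ?D (fst u, t *\<^sub>R snd u) (fst v, t *\<^sub>R snd v))) (at u)"
      by (rule has_derivative_compose)
    then show ?thesis by (rule has_derivative_mult_right)
  qed
  have bl: "blinfun_apply (Blinfun (?F u t)) = ?F u t" if "u \<in> ?S" for u t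
    using FD[OF that] by (intro bounded_linear_Blinfun_apply) (rule has_derivative_bounded_linear)
  have split: "?F u t v = p t * ?D (fst u, t *\<^sub>R snd u) (fst v, 0)
      + (p t * t) * ?D (fst u, t *\<^sub>R snd u) (0, snd v)" if "u \<in> ?S" for u t v
  proof -
    have l: "linear (?D (fst u, t *\<^sub>R snd u))"
      using that by (intro has_derivative_linear[OF fd]) auto
    have "?D (fst u, t *\<^sub>R snd u) ((fst v, 0) + t *\<^sub>R (0, snd v))
        = ?D (fst u, t *\<^sub>R snd u) (fst v, 0) + t * ?D (fst u, t *\<^sub>R snd u) (0, snd v)"
      by (simp only: linear_add[OF l] linear_cmul[OF l] real_scaleR_def)
    then have "?D (fst u, t *\<^sub>R snd u) (fst v, t *\<^sub>R snd v)
        = ?D (fst u, t *\<^sub>R snd u) (fst v, 0) + t * ?D (fst u, t *\<^sub>R snd u) (0, snd v)"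
      by simp
    then show ?thesis by (simp add: algebra_simps)
  qed
  have pt: "continuous_on {0..1} (\<lambda>t. p t * t)" using p by (intro continuous_intros)
  \<comment> \<open>The Leibniz rule wants the derivative as a continuous operator-valued integrand.
    In finite dimension this can be tested on each vector v, where \<open>split\<close> reduces it
    to two scalar ray integrands.\<close>
  have cF: "continuous_on (?B \<times> cbox 0 1) (\<lambda>z. Blinfun (?F (fst z) (snd z)))"
  proof (rule continuous_on_blinfun_componentwise)
    fix v :: "'e \<times> 'f"
    have "continuous_on (?B \<times> cbox 0 1) (\<lambda>z.
      p (snd z) * ?D (fst (fst z), snd z *\<^sub>R snd (fst z)) (fst v, 0)
      + (p (snd z) * snd z) * ?D (fst (fst z), snd z *\<^sub>R snd (fst z)) (0, snd v))"
      using continuous_on_ray_joint[OF cD p r(2)] continuous_on_ray_joint[OF cD pt r(2)]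
      by (intro continuous_on_add) auto
    then show "continuous_on (?B \<times> cbox 0 1) (\<lambda>z. blinfun_apply (Blinfun (?F (fst z) (snd z))) v)"
    proof (rule continuous_on_eq)
      fix z assume "z \<in> ?B \<times> cbox (0::real) 1"
      then have z: "fst z \<in> ?S" using r(2) by auto
      show "p (snd z) * ?D (fst (fst z), snd z *\<^sub>R snd (fst z)) (fst v, 0)
          + (p (snd z) * snd z) * ?D (fst (fst z), snd z *\<^sub>R snd (fst z)) (0, snd v)
        = blinfun_apply (Blinfun (?F (fst z) (snd z))) v"
        unfolding bl[OF z] by (rule split[OF z, symmetric])
    qed
  qed
  have "((\<lambda>u. integral (cbox 0 1) (\<lambda>t. p t * f (fst u, t *\<^sub>R snd u))) has_derivative
      blinfun_apply (integral (cbox 0 1) (\<lambda>t. Blinfun (?F u0 t)))) (at u0 within ?B)"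
  proof (rule leibniz_rule)
    show "((\<lambda>u. p t * f (fst u, t *\<^sub>R snd u)) has_derivative blinfun_apply (Blinfun (?F u t)))
        (at u within ?B)" if "u \<in> ?B" for u t
      using FD[of u t, THEN has_derivative_at_withinI] bl[of u t] that r(2) by auto
    show "(\<lambda>t. p t * f (fst u, t *\<^sub>R snd u)) integrable_on cbox 0 1" if "u \<in> ?B" for u
      using that r(2) p
      by (auto intro!: integrable_continuous_real continuous_on_mult continuous_on_ray[OF cf])
    show "continuous_on (?B \<times> cbox 0 1) (\<lambda>(u, t). Blinfun (?F u t))"
      using cF by (simp add: case_prod_beta')
  qed (use r(1) in auto)
  then have main: "(ray_integral p f has_derivative
      blinfun_apply (integral (cbox 0 1) (\<lambda>t. Blinfun (?F u0 t)))) (at u0)"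
    using r(1) at_within_open[of u0 ?B] by (simp add: ray_integral_def[abs_def])
  have "blinfun_apply (integral (cbox 0 1) (\<lambda>t. Blinfun (?F u0 t))) v =
      ray_integral p (\<lambda>u. ?D u (fst v, 0)) u0 + ray_integral (\<lambda>t. p t * t) (\<lambda>u. ?D u (0, snd v)) u0"
    for v
  proof -
    have "continuous_on (cbox 0 1) (\<lambda>t. Blinfun (?F (fst (u0, t)) (snd (u0, t))))"
      using r(1) by (intro continuous_on_compose2[OF cF] continuous_intros) auto
    then have "(\<lambda>t. Blinfun (?F u0 t)) integrable_on cbox 0 1"
      by (simp add: integrable_continuous_real)
    then have "blinfun_apply (integral (cbox 0 1) (\<lambda>t. Blinfun (?F u0 t))) v
      = integral (cbox 0 1) (\<lambda>t. ?F u0 t v)"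
      by (simp only: blinfun_apply_integral bl[OF u0])
    also have "\<dots> = integral {0..1} (\<lambda>t. p t * ?D (fst u0, t *\<^sub>R snd u0) (fst v, 0)
      + (p t * t) * ?D (fst u0, t *\<^sub>R snd u0) (0, snd v))"
      by (simp only: split[OF u0] cbox_interval)
    also have "\<dots> = ray_integral p (\<lambda>u. ?D u (fst v, 0)) u0
        + ray_integral (\<lambda>t. p t * t) (\<lambda>u. ?D u (0, snd v)) u0"
      unfolding ray_integral_def
      using u0 p pt by (intro integral_add integrable_continuous_real continuous_on_mult
          continuous_on_ray[OF cD]) auto
    finally show ?thesis .
  qed
  then show ?thesis by (intro has_derivative_eq_rhs[OF main] ext)
qed

text \<open>The derivative consists of two ray integrals of functions of one order less, one with
  the weight \<open>p t\<close> and one with \<open>p t * t\<close>. The induction must therefore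
  hold for all continuous weights at once.\<close>

lemma Ck_on_ray_integral:
  fixes f :: "'e::euclidean_space \<times> 'f::euclidean_space \<Rightarrow> real"
  assumes "open U" "continuous_on {0..1} p" "Ck_on k (U \<times> UNIV) f"
  shows "Ck_on k (U \<times> UNIV) (ray_integral p f)"
  using assms(2,3)
proof (induction k arbitrary: p f)
  case 0
  then show ?case by (simp add: continuous_on_ray_integral)
next
  case (Suc k)
  have S: "open (U \<times> (UNIV :: 'f set))" using assms(1) by (simp add: open_Times)
  have "Ck_on (Suc 0) (U \<times> UNIV) f"
    using Suc.prems(2) Ck_on_SucD by (induction k) blast+
  note d = ray_integral_has_derivative[OF assms(1) Suc.prems(1) this]
  have pt: "continuous_on {0..1} (\<lambda>t. p t * t)" using Suc.prems(1) by (intro continuous_intros)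
  show ?case
    by (rule Ck_on_SucI[OF S d Ck_on_add[OF S Suc.IH[OF Suc.prems(1) Ck_on_derivative]
          Suc.IH[OF pt Ck_on_derivative]]]) (use Suc.prems(2) in auto)
qed

text \<open>For fixed x, \<omega> is a 1-form on the fibre, closed by assumption. Differentiating
  P(x, y) in the fibre direction b gives the integral of \<omega> b + s D_b(\<omega> y) at (x, s y).
  Closedness turns D_b(\<omega> y) into D_y(\<omega> b), and the integrand becomes the s-derivative
  of s \<omega> b (x, s y).\<close>

lemma fibrewise_poincare:
  fixes \<omega> :: "'f::euclidean_space \<Rightarrow> 'e::euclidean_space \<times> 'f \<Rightarrow> real"
  assumes U: "open U" and \<omega>: "\<And>e. smooth_on (U \<times> UNIV) (\<omega> e)"
    and lin: "\<And>u. u \<in> U \<times> UNIV \<Longrightarrow> linear (\<lambda>e. \<omega> e u)"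
    and closed: "\<And>u a b. u \<in> U \<times> UNIV \<Longrightarrow>
      frechet_derivative (\<omega> a) (at u) (0, b) = frechet_derivative (\<omega> b) (at u) (0, a)"
  defines "P \<equiv> \<lambda>u. integral {0..1} (\<lambda>s. \<omega> (snd u) (fst u, s *\<^sub>R snd u))"
  shows "smooth_on (U \<times> UNIV) P"
    and "u \<in> U \<times> UNIV \<Longrightarrow> frechet_derivative P (at u) (0, b) = \<omega> b u"
proof -
  let ?S = "U \<times> (UNIV :: 'f set)"
  have S: "open ?S" using U by (simp add: open_Times)
  let ?R = "ray_integral (\<lambda>t. 1)"
  \<comment> \<open>In \<open>P\<close> the point also occurs as the argument of the 1-form.
    Expanding that argument in the standard basis leaves ray integrals of fixed functions \<omega>
    e, to which the differentiation lemma applies.\<close>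
  have P: "(\<Sum>e\<in>Basis. (snd u \<bullet> e) * ?R (\<omega> e) u) = P u" if "u \<in> ?S" for u
    unfolding P_def ray_integral_def mult_1 using that smooth_on_imp_continuous_on[OF \<omega>]
    by (intro linear_euclidean_expansion linear_integral lin continuous_on_ray[where U=U]) auto
  have "smooth_on ?S (?R (\<omega> e))" for e
    using \<omega>[of e] unfolding smooth_on_def
    by (intro allI Ck_on_ray_integral[OF U]) auto
  moreover have "smooth_on ?S (\<lambda>u. snd u \<bullet> e)" for e
    by (intro smooth_on_linear bounded_linear_inner_left_comp bounded_linear_snd)
  ultimately have "smooth_on ?S (\<lambda>u. \<Sum>e\<in>Basis. (snd u \<bullet> e) * ?R (\<omega> e) u)"
    by (intro smooth_on_sum[OF S] smooth_on_bilinear[OF bounded_bilinear_mult S])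
  from smooth_on_cong[OF S this P] show "smooth_on ?S P" by blast
  assume u: "u \<in> ?S"
  let ?D = "\<lambda>e u. frechet_derivative (\<omega> e) (at u)"
  let ?R' = "\<lambda>e v. ?R (\<lambda>u. ?D e u (fst v, 0)) u + ray_integral (\<lambda>t. 1 * t) (\<lambda>u. ?D e u (0, snd v)) u"
  have c1: "Ck_on (Suc 0) ?S (\<omega> e)" for e using \<omega> by (simp add: smooth_on_def)
  have D: "(\<omega> e has_derivative ?D e u) (at u)" if "u \<in> ?S" for e u
    using smooth_on_has_derivative[OF \<omega> that] .
  have "((\<lambda>u. \<Sum>e\<in>Basis. (snd u \<bullet> e) * ?R (\<omega> e) u) has_derivative
      (\<lambda>v. \<Sum>e\<in>Basis. (snd u \<bullet> e) * ?R' e v + (snd v \<bullet> e) * ?R (\<omega> e) u)) (at u)"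
    by (intro has_derivative_sum has_derivative_mult ray_integral_has_derivative[OF U _ c1 u]
        continuous_intros bounded_linear_imp_has_derivative bounded_linear_inner_left_comp
        bounded_linear_snd)
  then have "(P has_derivative
      (\<lambda>v. \<Sum>e\<in>Basis. (snd u \<bullet> e) * ?R' e v + (snd v \<bullet> e) * ?R (\<omega> e) u)) (at u)"
    by (rule has_derivative_transform_within_open[OF _ S u P])
  from frechet_derivative_at[OF this, symmetric]
  have "frechet_derivative P (at u) (0, b) =
      (\<Sum>e\<in>Basis. (snd u \<bullet> e) * ?R' e (0, b)) + (\<Sum>e\<in>Basis. (b \<bullet> e) * ?R (\<omega> e) u)"
    by (simp only: snd_conv sum.distrib)
  also have "(\<Sum>e\<in>Basis. (b \<bullet> e) * ?R (\<omega> e) u) = integral {0..1} (\<lambda>t. \<omega> b (fst u, t *\<^sub>R snd u))"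
    unfolding ray_integral_def mult_1 using u smooth_on_imp_continuous_on[OF \<omega>]
    by (intro linear_euclidean_expansion linear_integral lin continuous_on_ray[where U=U]) auto
  also have "(\<Sum>e\<in>Basis. (snd u \<bullet> e) * ?R' e (0, b)) =
    (\<Sum>e\<in>Basis. (snd u \<bullet> e) * integral {0..1} (\<lambda>t. t * ?D b (fst u, t *\<^sub>R snd u) (0, e)))"
  proof (rule sum.cong[OF refl])
    fix e
    have z: "?D e w 0 = 0" if "w \<in> ?S" for w
      using linear_0[OF has_derivative_linear[OF D[OF that]]] .
    \<comment> \<open>The direction (0, b) has no base component, so the part of the derivative
      along x vanishes.\<close>
    have "?R (\<lambda>u. ?D e u (fst (0 :: 'e, b), 0)) u = integral {0..1} (\<lambda>t::real. 0)"
      unfolding ray_integral_def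
      by (rule integral_cong) (use u z[unfolded zero_prod_def] in auto)
    \<comment> \<open>Closedness enters here: the derivative of \<omega> e along b becomes that of
      \<omega> b along e.\<close>
    moreover have "ray_integral (\<lambda>t. 1 * t) (\<lambda>u. ?D e u (0, snd (0 :: 'e, b))) u
        = integral {0..1} (\<lambda>t. t * ?D b (fst u, t *\<^sub>R snd u) (0, e))"
      unfolding ray_integral_def
      by (rule integral_cong) (use u in \<open>auto simp: closed[of _ e b]\<close>)
    ultimately show "(snd u \<bullet> e) * ?R' e (0, b) =
      (snd u \<bullet> e) * integral {0..1} (\<lambda>t. t * ?D b (fst u, t *\<^sub>R snd u) (0, e))" by simp
  qed
  also have "(\<Sum>e\<in>Basis. (snd u \<bullet> e) * integral {0..1} (\<lambda>t. t * ?D b (fst u, t *\<^sub>R snd u) (0, e)))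
    = integral {0..1} (\<lambda>t. t * ?D b (fst u, t *\<^sub>R snd u) (0, snd u))"
  proof (intro linear_euclidean_expansion linear_integral)
    show "linear (\<lambda>e. t * ?D b (fst u, t *\<^sub>R snd u) (0, e))" for t
    proof -
      have "linear (\<lambda>e::'f. (0::'e, e))" by (simp add: linear_iff)
      from linear_compose[OF this has_derivative_linear[OF D]]
      have "linear (\<lambda>e. ?D b (fst u, t *\<^sub>R snd u) (0, e))"
        using u by (auto simp: o_def)
      from linear_compose_scale_right[OF this, of t] show ?thesis by simp
    qed
    show "continuous_on {0..1} (\<lambda>t. t * ?D b (fst u, t *\<^sub>R snd u) (0, e))" for e
      using u by (intro continuous_on_mult continuous_intros continuous_on_ray[where U=U]
        smooth_on_imp_continuous_on smooth_on_derivative \<omega>) auto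
  qed
  also have "\<dots> + integral {0..1} (\<lambda>t. \<omega> b (fst u, t *\<^sub>R snd u)) =
    integral {0..1} (\<lambda>t. t * ?D b (fst u, t *\<^sub>R snd u) (0, snd u) + \<omega> b (fst u, t *\<^sub>R snd u))"
    using u by (intro integral_add[symmetric] integrable_continuous_real continuous_on_mult
        continuous_intros continuous_on_ray[where U=U]
        smooth_on_imp_continuous_on smooth_on_derivative \<omega>) auto
  also have "\<dots> = \<omega> b u"
  proof -
    \<comment> \<open>The integrand is an exact derivative; its primitive vanishes at t = 0 and
      equals \<omega> b u at t = 1.\<close>
    have "((\<lambda>t. t * \<omega> b (fst u, t *\<^sub>R snd u)) has_vector_derivative
        t * ?D b (fst u, t *\<^sub>R snd u) (0, snd u) + \<omega> b (fst u, t *\<^sub>R snd u)) (at t within {0..1})" for t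
    proof -
      have "((\<lambda>t. \<omega> b ((fst u, 0) + t *\<^sub>R (0, snd u))) has_real_derivative
          ?D b ((fst u, 0) + t *\<^sub>R (0, snd u)) (0, snd u)) (at t)"
        using u by (intro has_real_derivative_along_line D) auto
      then have "((\<lambda>t. t * \<omega> b (fst u, t *\<^sub>R snd u)) has_real_derivative
          t * ?D b (fst u, t *\<^sub>R snd u) (0, snd u) + \<omega> b (fst u, t *\<^sub>R snd u)) (at t)"
        by (auto intro!: derivative_eq_intros)
      then show ?thesis
        by (simp add: has_real_derivative_iff_has_vector_derivative has_vector_derivative_at_within)
    qed
    from fundamental_theorem_of_calculus[OF zero_le_one this] show ?thesis
      by (intro integral_unique) simp
  qed
  finally show "frechet_derivative P (at u) (0, b) = \<omega> b u" .
qed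

section \<open>Tangent vectors in charts\<close>

lemma apply_cinv: "u \<in> snd c ` fst c \<Longrightarrow> snd c (cinv c u) = u"
  unfolding cinv_def by (rule f_inv_into_f)

lemma cinv_in: "u \<in> snd c ` fst c \<Longrightarrow> cinv c u \<in> fst c"
  unfolding cinv_def by (rule inv_into_into)

lemma cinv_eqI: "inj_on (snd c) (fst c) \<Longrightarrow> p \<in> fst c \<Longrightarrow> snd c p = u \<Longrightarrow> cinv c u = p"
  unfolding cinv_def by (metis inv_into_f_f)

text \<open>The Jacobian at \<open>p\<close> of the coordinate change from \<open>c\<close> to
  \<open>d\<close>.\<close>

definition jac :: "('a, 'e::euclidean_space) chart \<Rightarrow> ('a, 'e) chart \<Rightarrow> 'a \<Rightarrow> 'e \<Rightarrow> 'e" where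
  "jac c d p = frechet_derivative (snd d \<circ> cinv c) (at (snd c p))"

locale atlas =
  fixes A :: "('a, 'e::euclidean_space) chart set"
  assumes smooth_atlas: "smooth_atlas A"
begin

lemma chart_inj: "c \<in> A \<Longrightarrow> inj_on (snd c) (fst c)"
  using smooth_atlas by (simp add: smooth_atlas_def)

lemma chart_open: "c \<in> A \<Longrightarrow> open (snd c ` fst c)"
  using smooth_atlas by (simp add: smooth_atlas_def)

lemma overlap_open: "c \<in> A \<Longrightarrow> d \<in> A \<Longrightarrow> open (snd c ` (fst c \<inter> fst d))"
  using smooth_atlas by (simp add: smooth_atlas_def)

lemma transition_smooth:
  "c \<in> A \<Longrightarrow> d \<in> A \<Longrightarrow> smooth_on (snd c ` (fst c \<inter> fst d)) (snd d \<circ> cinv c)"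
  using smooth_atlas by (simp add: smooth_atlas_def)

lemma cinv_apply: "c \<in> A \<Longrightarrow> p \<in> fst c \<Longrightarrow> cinv c (snd c p) = p"
  using chart_inj by (intro cinv_eqI) auto

lemma cinv_in_overlap:
  assumes "c \<in> A" "u \<in> snd c ` (fst c \<inter> X)"
  shows "cinv c u \<in> fst c" "cinv c u \<in> X"
  using assms cinv_apply[OF assms(1)] by auto

lemma transition_has_derivative:
  assumes "c \<in> A" "d \<in> A" "p \<in> fst c" "p \<in> fst d"
  shows "((snd d \<circ> cinv c) has_derivative jac c d p) (at (snd c p))"
  unfolding jac_def using assms
  by (intro smooth_on_has_derivative[OF transition_smooth]) auto

lemma linear_jac:
  assumes "c \<in> A" "d \<in> A" "p \<in> fst c" "p \<in> fst d"
  shows "linear (jac c d p)"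
  by (rule has_derivative_linear[OF transition_has_derivative[OF assms]])

lemma jac_refl:
  assumes "c \<in> A" "p \<in> fst c"
  shows "jac c c p a = a"
proof -
  have "((\<lambda>u. u) has_derivative (\<lambda>a. a)) (at (snd c p))" by (rule has_derivative_ident)
  then have "((snd c \<circ> cinv c) has_derivative (\<lambda>a. a)) (at (snd c p))"
    by (rule has_derivative_transform_within_open[OF _ chart_open[OF assms(1)]])
      (use assms(2) apply_cinv[of _ c] in auto)
  from frechet_derivative_at[OF this] show ?thesis unfolding jac_def by metis
qed

text \<open>The chain rule for coordinate changes. This cocycle identity is what makes the family
  built by \<open>tvec_of\<close> a tangent vector.\<close>

lemma jac_comp:
  assumes "c \<in> A" "d \<in> A" "e \<in> A" "p \<in> fst c" "p \<in> fst d" "p \<in> fst e"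
  shows "jac d e p (jac c d p a) = jac c e p a"
proof -
  have p: "(snd d \<circ> cinv c) (snd c p) = snd d p" using assms cinv_apply by simp
  have "((\<lambda>u. (snd e \<circ> cinv d) ((snd d \<circ> cinv c) u)) has_derivative (\<lambda>a. jac d e p (jac c d p a)))
      (at (snd c p))"
    by (rule has_derivative_compose[OF transition_has_derivative[OF assms(1,2,4,5)]])
      (unfold p, rule transition_has_derivative[OF assms(2,3,5,6)])
  then have "((snd e \<circ> cinv c) has_derivative (\<lambda>a. jac d e p (jac c d p a))) (at (snd c p))"
    by (rule has_derivative_transform_within_open[OF _ overlap_open[OF assms(1,2)]])
      (use assms cinv_apply[OF assms(1)] cinv_apply[OF assms(2)] in auto)
  from frechet_derivative_at[OF this] show ?thesis unfolding jac_def by metis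
qed

lemma tvec_of_apply: "tvec_of A c p a d = (if d \<in> A \<and> p \<in> fst d then jac c d p a else 0)"
  by (simp add: tvec_of_def jac_def)

lemma tangent_space_iff:
  "v \<in> tangent_space A p \<longleftrightarrow>
    (\<forall>c\<in>A. \<forall>d\<in>A. p \<in> fst c \<and> p \<in> fst d \<longrightarrow> v d = jac c d p (v c)) \<and>
    (\<forall>c. \<not> (c \<in> A \<and> p \<in> fst c) \<longrightarrow> v c = 0)"
  by (simp only: tangent_space_def jac_def Int_iff mem_Collect_eq)

lemma tvec_of_in: "c \<in> A \<Longrightarrow> p \<in> fst c \<Longrightarrow> tvec_of A c p a \<in> tangent_space A p"
  unfolding tangent_space_iff by (intro conjI ballI allI impI) (auto simp: tvec_of_apply jac_comp)

lemma tvec_of_self: "c \<in> A \<Longrightarrow> p \<in> fst c \<Longrightarrow> tvec_of A c p a c = a"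
  by (simp add: tvec_of_apply jac_refl)

lemma tangent_space_jac:
  "v \<in> tangent_space A p \<Longrightarrow> c \<in> A \<Longrightarrow> d \<in> A \<Longrightarrow> p \<in> fst c \<Longrightarrow> p \<in> fst d \<Longrightarrow>
    jac c d p (v c) = v d"
  unfolding tangent_space_iff by metis

text \<open>Together with \<open>tvec_of_self\<close> this identifies a tangent space with the model
  space through any single chart, although a tangent vector is stored as a family over all
  charts.\<close>

lemma tvec_of_component:
  assumes "c \<in> A" "p \<in> fst c" "v \<in> tangent_space A p"
  shows "tvec_of A c p (v c) = v"
proof
  fix d
  show "tvec_of A c p (v c) d = v d"
  proof (cases "d \<in> A \<and> p \<in> fst d")
    case True
    then show ?thesis using assms by (simp add: tvec_of_apply tangent_space_jac)
  next
    case False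
    then have "v d = 0" using assms(3) unfolding tangent_space_iff by blast
    with False show ?thesis by (simp only: tvec_of_apply if_False)
  qed
qed

lemma tangent_space_eqI:
  "c \<in> A \<Longrightarrow> p \<in> fst c \<Longrightarrow> v \<in> tangent_space A p \<Longrightarrow> w \<in> tangent_space A p \<Longrightarrow> v c = w c \<Longrightarrow> v = w"
  using tvec_of_component by metis

lemma tvec_of_lincomb:
  assumes "c \<in> A" "p \<in> fst c"
  shows "tvec_of A c p (r *\<^sub>R a + s *\<^sub>R b) = lincomb r (tvec_of A c p a) s (tvec_of A c p b)"
proof
  fix d
  show "tvec_of A c p (r *\<^sub>R a + s *\<^sub>R b) d = lincomb r (tvec_of A c p a) s (tvec_of A c p b) d"
  proof (cases "d \<in> A \<and> p \<in> fst d")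
    case True
    then have "linear (jac c d p)" using linear_jac assms by blast
    with True show ?thesis by (simp add: lincomb_def tvec_of_apply linear_add linear_cmul)
  qed (auto simp: lincomb_def tvec_of_apply)
qed

lemma tvec_of_0: "c \<in> A \<Longrightarrow> p \<in> fst c \<Longrightarrow> tvec_of A c p 0 = (\<lambda>c. 0)"
  using tvec_of_lincomb[of c p 0 0 0 0] by (simp add: lincomb_def)

text \<open>Moves a form on tangent vectors to the model space, where linear algebra in terms of a
  basis is available.\<close>

lemma bilinear_tvec_of:
  assumes "c \<in> A" "p \<in> fst c" "bilinear_on (tangent_space A p) B"
  shows "bilinear (\<lambda>a b. B (tvec_of A c p a) (tvec_of A c p b))"
proof -
  note in_T = tvec_of_in[OF assms(1,2)]
  have "B (tvec_of A c p (r *\<^sub>R a + s *\<^sub>R b)) (tvec_of A c p e) =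
      r * B (tvec_of A c p a) (tvec_of A c p e) + s * B (tvec_of A c p b) (tvec_of A c p e)"
    "B (tvec_of A c p e) (tvec_of A c p (r *\<^sub>R a + s *\<^sub>R b)) =
      r * B (tvec_of A c p e) (tvec_of A c p a) + s * B (tvec_of A c p e) (tvec_of A c p b)"
    for r s a b e
    using assms(3) in_T unfolding tvec_of_lincomb[OF assms(1,2)] bilinear_on_def by blast+
  \<comment> \<open>Both coefficients equal to 1 give additivity; the second coefficient equal to 0
    gives homogeneity.\<close>
  from this(1)[of 1 _ 1] this(1)[of _ _ 0] this(2)[of _ 1 _ 1] this(2)[of _ _ _ 0]
  show ?thesis unfolding bilinear_def linear_iff by simp
qed

end

section \<open>The atlases of the tangent and vertical tangent manifolds\<close>

text \<open>This is the fibre component of a coordinate change of the tangent bundle. Expanding the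
  vector in the basis gives a sum of products of linear coordinates with derivatives of \<phi> in
  fixed directions, each of which is smooth.\<close>

lemma smooth_on_tangent_part:
  fixes \<phi> :: "'e::euclidean_space \<Rightarrow> 'f::euclidean_space"
  assumes "open X" "smooth_on X \<phi>"
  shows "smooth_on (X \<times> UNIV) (\<lambda>u. frechet_derivative \<phi> (at (fst u)) (snd u))"
proof -
  have S: "open (X \<times> (UNIV :: 'e set))" using assms(1) by (simp add: open_Times)
  have "smooth_on (X \<times> UNIV) (\<lambda>u :: 'e \<times> 'e. snd u \<bullet> b)" for b
    by (intro smooth_on_linear bounded_linear_inner_left_comp bounded_linear_snd)
  moreover have "smooth_on (X \<times> (UNIV :: 'e set)) (\<lambda>u. frechet_derivative \<phi> (at (0 + fst u)) b)" for b
    by (rule smooth_on_affine_comp[OF bounded_linear_fst S _ smooth_on_derivative[OF assms(2)]]) auto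
  ultimately have "smooth_on (X \<times> (UNIV :: 'e set))
      (\<lambda>u. \<Sum>b\<in>Basis. (snd u \<bullet> b) *\<^sub>R frechet_derivative \<phi> (at (fst u)) b)"
    by (intro smooth_on_sum[OF S] smooth_on_bilinear[OF bounded_bilinear_scaleR S]) simp_all
  then show ?thesis
  proof (rule smooth_on_cong[OF S])
    fix u :: "'e \<times> 'e" assume "u \<in> X \<times> UNIV"
    then have "linear (frechet_derivative \<phi> (at (fst u)))"
      by (intro has_derivative_linear[OF smooth_on_has_derivative[OF assms(2)]]) auto
    then have "(\<Sum>b\<in>Basis. (snd u \<bullet> b) *\<^sub>R frechet_derivative \<phi> (at (fst u)) b)
      = frechet_derivative \<phi> (at (fst u)) (\<Sum>b\<in>Basis. (snd u \<bullet> b) *\<^sub>R b)"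
      by (simp add: linear_sum linear_cmul)
    then show "(\<Sum>b\<in>Basis. (snd u \<bullet> b) *\<^sub>R frechet_derivative \<phi> (at (fst u)) b)
      = frechet_derivative \<phi> (at (fst u)) (snd u)"
      by (simp add: euclidean_representation)
  qed
qed

lemma smooth_on_fst:
  assumes "open X" "smooth_on X f"
  shows "smooth_on (X \<times> UNIV) (\<lambda>u. f (fst u))"
proof -
  have "smooth_on (X \<times> UNIV) (\<lambda>u. f (0 + fst u))"
    using assms by (intro smooth_on_affine_comp[OF bounded_linear_fst _ _ assms(2)]) (auto simp: open_Times)
  then show ?thesis by simp
qed

context atlas
begin

abbreviation "TC \<equiv> tangent_chart A"

lemma fst_TC: "fst (TC c) = {\<xi> \<in> tangent_bundle A. fst \<xi> \<in> fst c}"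
  and snd_TC: "snd (TC c) \<xi> = (snd c (fst \<xi>), snd \<xi> c)"
  by (simp_all add: tangent_chart_def)

lemma in_TC: "\<xi> \<in> fst (TC c) \<longleftrightarrow> \<xi> \<in> tangent_bundle A \<and> fst \<xi> \<in> fst c"
  by (simp add: fst_TC)

lemma TC_in: "c \<in> A \<Longrightarrow> TC c \<in> tangent_atlas A"
  by (simp add: tangent_atlas_def)

lemma tangent_bundleD: "\<xi> \<in> tangent_bundle A \<Longrightarrow> snd \<xi> \<in> tangent_space A (fst \<xi>)"
  by (auto simp: tangent_bundle_def)

lemma tangent_bundle_chart:
  assumes "\<xi> \<in> tangent_bundle A"
  obtains c where "c \<in> A" "fst \<xi> \<in> fst c"
  using assms by (auto simp: tangent_bundle_def carrier_of_def)

lemma tangent_bundle_tvec_of: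
  "c \<in> A \<Longrightarrow> p \<in> fst c \<Longrightarrow> (p, tvec_of A c p y) \<in> tangent_bundle A"
  by (auto simp: tangent_bundle_def carrier_of_def tvec_of_in)

lemma inj_TC: "c \<in> A \<Longrightarrow> inj_on (snd (TC c)) (fst (TC c))"
  by (rule inj_onI) (metis (no_types, lifting) Pair_inject chart_inj in_TC inj_onD prod_eqI snd_TC
      tangent_bundleD tangent_space_eqI)

lemma TC_image:
  assumes "c \<in> A" "X \<subseteq> fst c"
  shows "snd (TC c) ` {\<xi> \<in> tangent_bundle A. fst \<xi> \<in> X} = snd c ` X \<times> UNIV"
proof (intro equalityI subsetI)
  fix u assume "u \<in> snd c ` X \<times> (UNIV :: 'e set)"
  then obtain p y where u: "u = (snd c p, y)" "p \<in> X" by (metis imageE mem_Sigma_iff surj_pair)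
  then have "u = snd (TC c) (p, tvec_of A c p y)"
    using assms by (auto simp: snd_TC tvec_of_self subset_eq)
  moreover have "(p, tvec_of A c p y) \<in> tangent_bundle A"
    using u assms by (intro tangent_bundle_tvec_of) auto
  ultimately show "u \<in> snd (TC c) ` {\<xi> \<in> tangent_bundle A. fst \<xi> \<in> X}" using u(2) by auto
qed (auto simp: snd_TC)

lemma TC_range: "c \<in> A \<Longrightarrow> snd (TC c) ` fst (TC c) = snd c ` fst c \<times> UNIV"
  using TC_image[of c "fst c"] by (simp add: fst_TC)

lemma TC_overlap_range:
  assumes "c \<in> A" "d \<in> A"
  shows "snd (TC c) ` (fst (TC c) \<inter> fst (TC d)) = snd c ` (fst c \<inter> fst d) \<times> UNIV"
proof -
  have "fst (TC c) \<inter> fst (TC d) = {\<xi> \<in> tangent_bundle A. fst \<xi> \<in> fst c \<inter> fst d}"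
    by (auto simp: fst_TC)
  then show ?thesis using TC_image[OF assms(1), of "fst c \<inter> fst d"] by simp
qed

lemma cinv_TC:
  assumes "c \<in> A" "x \<in> snd c ` fst c"
  shows "cinv (TC c) (x, y) = (cinv c x, tvec_of A c (cinv c x) y)"
  using assms cinv_in[OF assms(2)]
  by (intro cinv_eqI inj_TC) (auto simp: in_TC snd_TC tangent_bundle_tvec_of apply_cinv tvec_of_self)

lemma TC_transition:
  assumes "c \<in> A" "d \<in> A" "x \<in> snd c ` (fst c \<inter> fst d)"
  shows "(snd (TC d) \<circ> cinv (TC c)) (x, y) =
    ((snd d \<circ> cinv c) x, frechet_derivative (snd d \<circ> cinv c) (at x) y)"
proof -
  have x: "x \<in> snd c ` fst c" using assms(3) by auto
  show ?thesis
    using assms cinv_in_overlap[OF assms(1,3)]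
    by (simp add: cinv_TC[OF assms(1) x] snd_TC tvec_of_apply jac_def apply_cinv[OF x])
qed

lemma smooth_atlas_TC: "smooth_atlas (tangent_atlas A)"
  unfolding smooth_atlas_def tangent_atlas_def ball_simps
proof (intro conjI ballI)
  fix c d assume c: "c \<in> A" and d: "d \<in> A"
  let ?X = "snd c ` (fst c \<inter> fst d)"
  note X = overlap_open[OF c d]
  show "inj_on (snd (TC c)) (fst (TC c))" by (rule inj_TC[OF c])
  show "open (snd (TC c) ` fst (TC c))"
    unfolding TC_range[OF c] by (intro open_Times chart_open[OF c] open_UNIV)
  show O: "open (snd (TC c) ` (fst (TC c) \<inter> fst (TC d)))"
    unfolding TC_overlap_range[OF c d] by (intro open_Times X open_UNIV)
  have "smooth_on (?X \<times> UNIV) (\<lambda>u. ((snd d \<circ> cinv c) (fst u),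
      frechet_derivative (snd d \<circ> cinv c) (at (fst u)) (snd u)))"
    using O[unfolded TC_overlap_range[OF c d]]
    by (intro smooth_on_Pair smooth_on_tangent_part smooth_on_fst X transition_smooth c d)
  then show "smooth_on (snd (TC c) ` (fst (TC c) \<inter> fst (TC d))) (snd (TC d) \<circ> cinv (TC c))"
    unfolding TC_overlap_range[OF c d]
    by (rule smooth_on_cong[OF O[unfolded TC_overlap_range[OF c d]]])
      (use TC_transition[OF c d] in force)
qed

lemma carrier_of_TC: "carrier_of (tangent_atlas A) = tangent_bundle A"
  unfolding carrier_of_def tangent_atlas_def by (auto simp: fst_TC tangent_bundle_def carrier_of_def)

end

text \<open>\<open>tangent_map\<close> evaluates in a chart picked by \<open>SOME\<close>, so the
  value is computed in every admissible chart.\<close>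

lemma (in atlas) tangent_map_eqI:
  assumes "\<And>c. c \<in> A \<Longrightarrow> p \<in> fst c \<Longrightarrow>
      frechet_derivative (snd d \<circ> f \<circ> cinv c) (at (snd c p)) (v c) = w"
    and "p \<in> carrier_of A" "d \<in> B" "f p \<in> fst d"
  shows "tangent_map A B f p v d = w"
proof -
  have "\<exists>c. c \<in> A \<and> p \<in> fst c" using assms(2) by (auto simp: carrier_of_def)
  from someI_ex[OF this] show ?thesis
    using assms(1,3,4) by (simp add: tangent_map_def Let_def)
qed

locale manifold_atlas = atlas A for A :: "('a, real^'m::finite) chart set"
begin

sublocale T: atlas "tangent_atlas A"
  by unfold_locales (rule smooth_atlas_TC)

lemma in_tangent_atlas:
  assumes "C \<in> tangent_atlas A" "\<xi> \<in> fst C"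
  obtains c where "c \<in> A" "C = TC c" "\<xi> \<in> tangent_bundle A" "fst \<xi> \<in> fst c"
  using assms by (auto simp: tangent_atlas_def in_TC)

lemma fst_transition_TC_has_derivative:
  assumes "c \<in> A" "d \<in> A" "\<xi> \<in> tangent_bundle A" "fst \<xi> \<in> fst c" "fst \<xi> \<in> fst d"
  shows "((\<lambda>u. (snd d \<circ> cinv c) (fst u)) has_derivative (\<lambda>v. jac c d (fst \<xi>) (fst v)))
    (at (snd (TC c) \<xi>))"
  by (rule has_derivative_compose[OF has_derivative_fst[OF has_derivative_ident]])
    (simp only: snd_TC fst_conv, rule transition_has_derivative[OF assms(1,2,4,5)])

lemma snd_TC_in_overlap:
  "\<xi> \<in> tangent_bundle A \<Longrightarrow> fst \<xi> \<in> fst c \<Longrightarrow> fst \<xi> \<in> fst d \<Longrightarrow>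
    snd (TC c) \<xi> \<in> snd c ` (fst c \<inter> fst d) \<times> UNIV"
  by (auto simp: snd_TC)

lemma fst_jac_TC:
  assumes "c \<in> A" "d \<in> A" "\<xi> \<in> tangent_bundle A" "fst \<xi> \<in> fst c" "fst \<xi> \<in> fst d"
  shows "fst (jac (TC c) (TC d) \<xi> v) = jac c d (fst \<xi>) (fst v)"
proof -
  let ?\<Phi> = "snd (TC d) \<circ> cinv (TC c)"
  have "(?\<Phi> has_derivative jac (TC c) (TC d) \<xi>) (at (snd (TC c) \<xi>))"
    using assms by (intro T.transition_has_derivative TC_in) (simp_all add: in_TC)
  then have 1: "((\<lambda>u. fst (?\<Phi> u)) has_derivative (\<lambda>v. fst (jac (TC c) (TC d) \<xi> v)))
      (at (snd (TC c) \<xi>))"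
    by (rule has_derivative_fst)
  have "((\<lambda>u. fst (?\<Phi> u)) has_derivative (\<lambda>v. jac c d (fst \<xi>) (fst v))) (at (snd (TC c) \<xi>))"
  proof (rule has_derivative_transform_within_open[OF fst_transition_TC_has_derivative[OF assms]])
    show "open (snd c ` (fst c \<inter> fst d) \<times> (UNIV :: (real^'m) set))"
      by (intro open_Times overlap_open assms open_UNIV)
    show "snd (TC c) \<xi> \<in> snd c ` (fst c \<inter> fst d) \<times> UNIV"
      using assms(3-5) by (rule snd_TC_in_overlap)
    show "(snd d \<circ> cinv c) (fst u) = fst (?\<Phi> u)"
      if "u \<in> snd c ` (fst c \<inter> fst d) \<times> UNIV" for u
      using TC_transition[OF assms(1,2), of "fst u" "snd u"] that by (auto simp del: o_apply)
  qed
  from has_derivative_unique[OF 1 this] show ?thesis by metis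
qed

text \<open>With x fixed, the fibre part of the coordinate change is the linear map
  \<open>jac c d\<close>, which is its own derivative. The second derivatives of the base change,
  present in the full Jacobian, act on horizontal components only.\<close>

lemma jac_TC_vertical:
  assumes "c \<in> A" "d \<in> A" "\<xi> \<in> tangent_bundle A" "fst \<xi> \<in> fst c" "fst \<xi> \<in> fst d"
  shows "jac (TC c) (TC d) \<xi> (0, b) = (0, jac c d (fst \<xi>) b)"
proof -
  let ?\<Phi> = "snd (TC d) \<circ> cinv (TC c)"
  let ?x = "snd c (fst \<xi>)"
  have lin: "linear (jac c d (fst \<xi>))" by (rule linear_jac[OF assms(1,2,4,5)])
  have \<Phi>: "(?\<Phi> has_derivative jac (TC c) (TC d) \<xi>) (at (?x, snd \<xi> c))"
    unfolding snd_TC[symmetric]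
    using assms by (intro T.transition_has_derivative TC_in) (simp_all add: in_TC)
  have "((\<lambda>y. (?x, y)) has_derivative (\<lambda>b. (0, b))) (at (snd \<xi> c))"
    by (auto intro!: derivative_eq_intros)
  from has_derivative_snd[OF has_derivative_compose[OF this \<Phi>]]
  have 1: "((\<lambda>y. snd (?\<Phi> (?x, y))) has_derivative (\<lambda>b. snd (jac (TC c) (TC d) \<xi> (0, b))))
      (at (snd \<xi> c))" .
  have x: "?x \<in> snd c ` (fst c \<inter> fst d)" using assms by auto
  have "(\<lambda>y. snd (?\<Phi> (?x, y))) = jac c d (fst \<xi>)"
    using TC_transition[OF assms(1,2) x] by (simp add: jac_def fun_eq_iff del: o_apply)
  moreover have "(jac c d (fst \<xi>) has_derivative jac c d (fst \<xi>)) (at (snd \<xi> c))"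
    using lin by (intro bounded_linear_imp_has_derivative) (simp add: linear_conv_bounded_linear)
  ultimately have "snd (jac (TC c) (TC d) \<xi> (0, b)) = jac c d (fst \<xi>) b"
    using has_derivative_unique[OF 1] by metis
  then show ?thesis
    using fst_jac_TC[OF assms, of "(0, b)"] linear_0[OF lin] by (simp add: prod_eq_iff)
qed

lemma tangent_map_fst:
  assumes "\<xi> \<in> tangent_bundle A" "w \<in> tangent_space (tangent_atlas A) \<xi>" "d \<in> A" "fst \<xi> \<in> fst d"
  shows "tangent_map (tangent_atlas A) A fst \<xi> w d = fst (w (TC d))"
proof (rule T.tangent_map_eqI)
  fix C assume "C \<in> tangent_atlas A" "\<xi> \<in> fst C"
  then obtain c where c: "c \<in> A" "C = TC c" "fst \<xi> \<in> fst c" by (rule in_tangent_atlas)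
  have "((snd d \<circ> fst \<circ> cinv C) has_derivative (\<lambda>v. jac c d (fst \<xi>) (fst v))) (at (snd C \<xi>))"
    unfolding c(2)
  proof (rule has_derivative_transform_within_open
      [OF fst_transition_TC_has_derivative[OF c(1) assms(3,1) c(3) assms(4)]])
    show "open (snd c ` (fst c \<inter> fst d) \<times> (UNIV :: (real^'m) set))"
      by (intro open_Times overlap_open assms c open_UNIV)
    show "snd (TC c) \<xi> \<in> snd c ` (fst c \<inter> fst d) \<times> UNIV"
      using assms(1) c(3) assms(4) by (rule snd_TC_in_overlap)
    show "(snd d \<circ> cinv c) (fst u) = (snd d \<circ> fst \<circ> cinv (TC c)) u"
      if "u \<in> snd c ` (fst c \<inter> fst d) \<times> UNIV" for u
      using cinv_TC[OF c(1), of "fst u" "snd u"] that by auto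
  qed
  then have "frechet_derivative (snd d \<circ> fst \<circ> cinv C) (at (snd C \<xi>)) = (\<lambda>v. jac c d (fst \<xi>) (fst v))"
    by (rule frechet_derivative_at[symmetric])
  then show "frechet_derivative (snd d \<circ> fst \<circ> cinv C) (at (snd C \<xi>)) (w C) = fst (w (TC d))"
    using fst_jac_TC[OF c(1) assms(3,1) c(3) assms(4), of "w C"]
      T.tangent_space_jac[OF assms(2) TC_in[OF c(1)] TC_in[OF assms(3)]] c assms
    by (simp add: in_TC)
qed (use assms carrier_of_TC in auto)

text \<open>Base components transform by an invertible linear Jacobian, so their vanishing in one
  chart means their vanishing in all, which is the kernel condition in
  \<open>vertical\<close>.\<close>

lemma vertical_iff:
  assumes "\<xi> \<in> tangent_bundle A" "c \<in> A" "fst \<xi> \<in> fst c"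
  shows "w \<in> vertical A \<xi> \<longleftrightarrow> w \<in> tangent_space (tangent_atlas A) \<xi> \<and> fst (w (TC c)) = 0"
proof
  assume "w \<in> vertical A \<xi>"
  then have w: "w \<in> tangent_space (tangent_atlas A) \<xi>"
    and "tangent_map (tangent_atlas A) A fst \<xi> w c = 0"
    by (simp_all add: vertical_def)
  then show "w \<in> tangent_space (tangent_atlas A) \<xi> \<and> fst (w (TC c)) = 0"
    using tangent_map_fst[OF assms(1) w assms(2,3)] by simp
next
  assume w: "w \<in> tangent_space (tangent_atlas A) \<xi> \<and> fst (w (TC c)) = 0"
  have "tangent_map (tangent_atlas A) A fst \<xi> w d = 0" for d
  proof (cases "d \<in> A \<and> fst \<xi> \<in> fst d")
    case True
    then have d: "d \<in> A" "fst \<xi> \<in> fst d" by auto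
    have "fst (w (TC d)) = jac c d (fst \<xi>) (fst (w (TC c)))"
      using fst_jac_TC[OF assms(2) d(1) assms(1,3) d(2), of "w (TC c)"] w d assms
        T.tangent_space_jac[of w \<xi> "TC c" "TC d"] by (simp add: in_TC TC_in)
    then show ?thesis
      using w d assms linear_0[OF linear_jac[of c d "fst \<xi>"]] tangent_map_fst by simp
  qed (auto simp: tangent_map_def)
  with w show "w \<in> vertical A \<xi>" by (auto simp: vertical_def)
qed

text \<open>The vertical vector \<open>b^i d/dy^i\<close> at \<xi>.\<close>

abbreviation "vlift c \<xi> b \<equiv> tvec_of (tangent_atlas A) (TC c) \<xi> (0, b)"

lemma vlift_in:
  assumes "\<xi> \<in> tangent_bundle A" "c \<in> A" "fst \<xi> \<in> fst c"
  shows "vlift c \<xi> b \<in> tangent_space (tangent_atlas A) \<xi>"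
  using assms by (simp add: T.tvec_of_in in_TC TC_in)

lemma vlift_self:
  assumes "\<xi> \<in> tangent_bundle A" "c \<in> A" "fst \<xi> \<in> fst c"
  shows "vlift c \<xi> b (TC c) = (0, b)"
  using assms by (simp add: T.tvec_of_self in_TC TC_in)

lemma vlift_vertical:
  assumes "\<xi> \<in> tangent_bundle A" "c \<in> A" "fst \<xi> \<in> fst c"
  shows "vlift c \<xi> b \<in> vertical A \<xi>"
  by (simp add: vertical_iff[OF assms] vlift_in[OF assms] vlift_self[OF assms])

lemma vertical_vlift:
  assumes "\<xi> \<in> tangent_bundle A" "c \<in> A" "fst \<xi> \<in> fst c" "w \<in> vertical A \<xi>"
  shows "w = vlift c \<xi> (snd (w (TC c)))"
proof -
  have "w \<in> tangent_space (tangent_atlas A) \<xi>" "w (TC c) = (0, snd (w (TC c)))"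
    using assms(4) by (simp_all add: vertical_iff[OF assms(1-3)] prod_eq_iff)
  then show ?thesis
    using T.tvec_of_component[of "TC c" \<xi> w] assms by (simp add: in_TC TC_in)
qed

lemma vlift_jac:
  assumes "\<xi> \<in> tangent_bundle A" "c \<in> A" "fst \<xi> \<in> fst c" "d \<in> A" "fst \<xi> \<in> fst d"
  shows "vlift c \<xi> b (TC d) = (0, jac c d (fst \<xi>) b)"
  using assms by (simp add: T.tvec_of_apply in_TC TC_in jac_TC_vertical)

section \<open>The charts of the vertical tangent manifold\<close>

abbreviation "VC \<equiv> vertical_chart A"

lemma vertical_bundle_iff:
  "Z \<in> vertical_bundle A \<longleftrightarrow> fst Z \<in> tangent_bundle A \<and> snd Z \<in> vertical A (fst Z)"
  by (auto simp: vertical_bundle_def)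

lemma in_VC: "Z \<in> fst (VC c) \<longleftrightarrow> Z \<in> vertical_bundle A \<and> vproj Z \<in> fst c"
  by (simp add: vertical_chart_def vproj_def)

lemma fst_VC: "fst (VC c) = {Z \<in> vertical_bundle A. vproj Z \<in> fst c}"
  by (simp add: vertical_chart_def vproj_def)

lemma snd_VC: "snd (VC c) Z = (snd c (vproj Z), snd (fst Z) c, snd (snd Z (TC c)))"
  by (simp add: vertical_chart_def vproj_def)

lemma VC_in: "c \<in> A \<Longrightarrow> VC c \<in> vertical_atlas A"
  by (simp add: vertical_atlas_def)

lemma inj_VC:
  assumes "c \<in> A"
  shows "inj_on (snd (VC c)) (fst (VC c))"
proof (rule inj_onI)
  fix Z Z' assume Z: "Z \<in> fst (VC c)" "Z' \<in> fst (VC c)" and eq: "snd (VC c) Z = snd (VC c) Z'"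
  have T: "fst Z \<in> fst (TC c)" "fst Z' \<in> fst (TC c)"
    using Z by (simp_all add: in_VC in_TC vertical_bundle_iff vproj_def)
  have "snd (TC c) (fst Z) = snd (TC c) (fst Z')"
    using eq by (simp add: snd_VC snd_TC vproj_def)
  then have 1: "fst Z = fst Z'" using inj_onD[OF inj_TC[OF assms]] T by blast
  have "snd Z = vlift c (fst Z) (snd (snd Z (TC c)))" "snd Z' = vlift c (fst Z') (snd (snd Z' (TC c)))"
    using Z assms by (auto intro!: vertical_vlift simp: in_VC vertical_bundle_iff vproj_def)
  moreover have "snd (snd Z (TC c)) = snd (snd Z' (TC c))" using eq by (simp add: snd_VC)
  ultimately have "snd Z = snd Z'" using 1 by metis
  with 1 show "Z = Z'" by (rule prod_eqI)
qed

text \<open>The inverse of the chart map: the point over \<open>p\<close> with fibre coordinates y =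
  fst u and \<eta> = snd u. For fixed \<open>p\<close> it parametrises a leaf.\<close>

definition vpoint :: "('a, real^'m) chart \<Rightarrow> 'a \<Rightarrow> (real^'m) \<times> (real^'m) \<Rightarrow> ('a, 'm) vpt" where
  "vpoint c p u = ((p, tvec_of A c p (fst u)), vlift c (p, tvec_of A c p (fst u)) (snd u))"

lemma vpoint:
  assumes "c \<in> A" "p \<in> fst c"
  shows "vpoint c p u \<in> vertical_bundle A" "vproj (vpoint c p u) = p"
    "snd (VC c) (vpoint c p u) = (snd c p, u)"
  using assms
  by (simp_all add: vpoint_def vertical_bundle_iff tangent_bundle_tvec_of vlift_vertical vproj_def
      snd_VC tvec_of_self vlift_self)

lemma VC_image:
  assumes "c \<in> A" "X \<subseteq> fst c"
  shows "snd (VC c) ` {Z \<in> vertical_bundle A. vproj Z \<in> X} = snd c ` X \<times> UNIV"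
proof (intro equalityI subsetI)
  fix u assume "u \<in> snd c ` X \<times> (UNIV :: ((real^'m) \<times> (real^'m)) set)"
  then obtain p y where u: "u = (snd c p, y)" "p \<in> X" by (metis imageE mem_Sigma_iff surj_pair)
  then have "u = snd (VC c) (vpoint c p y)" "vpoint c p y \<in> {Z \<in> vertical_bundle A. vproj Z \<in> X}"
    using assms by (auto simp: vpoint subset_eq)
  then show "u \<in> snd (VC c) ` {Z \<in> vertical_bundle A. vproj Z \<in> X}" by (rule image_eqI)
qed (auto simp: snd_VC)

lemma VC_range: "c \<in> A \<Longrightarrow> snd (VC c) ` fst (VC c) = snd c ` fst c \<times> UNIV"
  using VC_image[of c "fst c"] by (simp add: fst_VC)

lemma VC_overlap_range:
  assumes "c \<in> A" "d \<in> A"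
  shows "snd (VC c) ` (fst (VC c) \<inter> fst (VC d)) = snd c ` (fst c \<inter> fst d) \<times> UNIV"
proof -
  have "fst (VC c) \<inter> fst (VC d) = {Z \<in> vertical_bundle A. vproj Z \<in> fst c \<inter> fst d}"
    by (auto simp: fst_VC)
  then show ?thesis using VC_image[OF assms(1), of "fst c \<inter> fst d"] by simp
qed

lemma cinv_VC:
  assumes "c \<in> A" "x \<in> snd c ` fst c"
  shows "cinv (VC c) (x, u) = vpoint c (cinv c x) u"
  using assms cinv_in[OF assms(2)]
  by (intro cinv_eqI inj_VC) (auto simp: in_VC vpoint apply_cinv)

lemma snd_VC_vpoint:
  assumes "c \<in> A" "d \<in> A" "p \<in> fst c" "p \<in> fst d"
  shows "snd (VC d) (vpoint c p u) = (snd d p, jac c d p (fst u), jac c d p (snd u))"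
  using assms
  by (simp add: snd_VC vproj_def vpoint_def tvec_of_apply vlift_jac tangent_bundle_tvec_of)

lemma VC_transition:
  assumes "c \<in> A" "d \<in> A" "x \<in> snd c ` (fst c \<inter> fst d)"
  shows "(snd (VC d) \<circ> cinv (VC c)) (x, u) =
    ((snd d \<circ> cinv c) x, frechet_derivative (snd d \<circ> cinv c) (at x) (fst u),
     frechet_derivative (snd d \<circ> cinv c) (at x) (snd u))"
proof -
  have x: "x \<in> snd c ` fst c" using assms(3) by auto
  show ?thesis
    using assms cinv_in_overlap[OF assms(1,3)]
    by (simp add: cinv_VC[OF assms(1) x] snd_VC_vpoint jac_def apply_cinv[OF x])
qed

lemma smooth_atlas_VC: "smooth_atlas (vertical_atlas A)"
  unfolding smooth_atlas_def vertical_atlas_def ball_simps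
proof (intro conjI ballI)
  fix c d assume c: "c \<in> A" and d: "d \<in> A"
  let ?X = "snd c ` (fst c \<inter> fst d)"
  let ?S = "?X \<times> (UNIV :: ((real^'m) \<times> (real^'m)) set)"
  let ?\<phi> = "snd d \<circ> cinv c"
  note X = overlap_open[OF c d] and \<phi> = transition_smooth[OF c d]
  have S: "open ?S" by (intro open_Times X open_UNIV)
  show "inj_on (snd (VC c)) (fst (VC c))" by (rule inj_VC[OF c])
  show "open (snd (VC c) ` fst (VC c))"
    unfolding VC_range[OF c] by (intro open_Times chart_open[OF c] open_UNIV)
  show "open (snd (VC c) ` (fst (VC c) \<inter> fst (VC d)))"
    unfolding VC_overlap_range[OF c d] by (rule S)
  \<comment> \<open>\<open>L\<close> will be each of the two projections of (y, \<eta>), since both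
    fibre coordinates transform by the same Jacobian.\<close>
  have part: "smooth_on ?S (\<lambda>u. frechet_derivative ?\<phi> (at (fst u)) (L (snd u)))"
    if "bounded_linear L" for L
  proof -
    have "bounded_linear (\<lambda>u::(real^'m) \<times> (real^'m) \<times> (real^'m). (fst u, L (snd u)))"
      by (intro bounded_linear_Pair bounded_linear_fst bounded_linear_compose[OF that bounded_linear_snd])
    from smooth_on_affine_comp[OF this S _ smooth_on_tangent_part[OF X \<phi>], of 0]
    show ?thesis by force
  qed
  have "smooth_on ?S (\<lambda>u. (?\<phi> (fst u), frechet_derivative ?\<phi> (at (fst u)) (fst (snd u)),
      frechet_derivative ?\<phi> (at (fst u)) (snd (snd u))))"
    by (intro smooth_on_Pair S smooth_on_fst X \<phi> part bounded_linear_fst bounded_linear_snd)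
  then show "smooth_on (snd (VC c) ` (fst (VC c) \<inter> fst (VC d))) (snd (VC d) \<circ> cinv (VC c))"
    unfolding VC_overlap_range[OF c d]
    by (rule smooth_on_cong[OF S]) (use VC_transition[OF c d] in force)
qed

lemma carrier_of_VC: "carrier_of (vertical_atlas A) = vertical_bundle A"
proof
  show "vertical_bundle A \<subseteq> carrier_of (vertical_atlas A)"
  proof
    fix Z assume Z: "Z \<in> vertical_bundle A"
    then obtain c where "c \<in> A" "vproj Z \<in> fst c"
      unfolding vproj_def vertical_bundle_iff using tangent_bundle_chart by blast
    with Z show "Z \<in> carrier_of (vertical_atlas A)"
      unfolding carrier_of_def vertical_atlas_def by (auto simp: fst_VC)
  qed
qed (auto simp: carrier_of_def vertical_atlas_def fst_VC)

sublocale V: atlas "vertical_atlas A"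
  by unfold_locales (rule smooth_atlas_VC)

text \<open>Along a leaf the coordinate change is linear and consists of two copies of the base
  Jacobian, up to a constant base component.\<close>

lemma jac_VC_vertical:
  assumes "c \<in> A" "d \<in> A" "Z \<in> vertical_bundle A" "vproj Z \<in> fst c" "vproj Z \<in> fst d"
  shows "jac (VC c) (VC d) Z (0, u) = (0, jac c d (vproj Z) (fst u), jac c d (vproj Z) (snd u))"
proof -
  let ?\<Phi> = "snd (VC d) \<circ> cinv (VC c)" and ?J = "jac c d (vproj Z)"
  let ?x = "snd c (vproj Z)"
  have x: "?x \<in> snd c ` (fst c \<inter> fst d)" using assms by auto
  have lin: "bounded_linear ?J"
    using linear_jac[OF assms(1,2,4,5)] by (simp add: linear_conv_bounded_linear)
  obtain y where y: "snd (VC c) Z = (?x, y)" by (simp add: snd_VC)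
  have \<Phi>: "(?\<Phi> has_derivative jac (VC c) (VC d) Z) (at (?x, y))"
    unfolding y[symmetric]
    using assms by (intro V.transition_has_derivative VC_in) (simp_all add: in_VC)
  have "((\<lambda>y. (?x, y)) has_derivative (\<lambda>b. (0, b))) (at y)"
    by (auto intro!: derivative_eq_intros)
  from has_derivative_compose[OF this \<Phi>]
  have 1: "((\<lambda>y. ?\<Phi> (?x, y)) has_derivative (\<lambda>u. jac (VC c) (VC d) Z (0, u))) (at y)" .
  have eq: "(\<lambda>y. ?\<Phi> (?x, y)) = (\<lambda>u. ((snd d \<circ> cinv c) ?x, ?J (fst u), ?J (snd u)))"
    using VC_transition[OF assms(1,2) x] by (simp add: jac_def fun_eq_iff del: o_apply)
  have "((\<lambda>u. ((snd d \<circ> cinv c) ?x, ?J (fst u), ?J (snd u))) has_derivative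
      (\<lambda>u. (0, ?J (fst u), ?J (snd u)))) (at y)"
    by (intro has_derivative_Pair has_derivative_const bounded_linear_imp_has_derivative
        bounded_linear_compose[OF lin bounded_linear_fst] bounded_linear_compose[OF lin bounded_linear_snd])
  from has_derivative_unique[OF 1[unfolded eq] this] show ?thesis by (rule fun_cong)
qed

section \<open>Leaves and their inclusion\<close>

abbreviation "LC \<equiv> leaf_chart A"

lemma fst_LC: "fst (LC q c) = leaf A q"
  and snd_LC: "snd (LC q c) Z = snd (snd (VC c) Z)"
  by (simp_all add: leaf_chart_def vertical_chart_def)

lemma in_leaf: "Z \<in> leaf A q \<longleftrightarrow> Z \<in> vertical_bundle A \<and> vproj Z = q"
  by (simp add: leaf_def)

lemma LC_in: "c \<in> A \<Longrightarrow> q \<in> fst c \<Longrightarrow> LC q c \<in> leaf_atlas A q"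
  by (simp add: leaf_atlas_def)

lemma inj_LC:
  assumes "c \<in> A" "q \<in> fst c"
  shows "inj_on (snd (LC q c)) (leaf A q)"
proof (rule inj_onI)
  fix Z Z' assume "Z \<in> leaf A q" "Z' \<in> leaf A q" "snd (LC q c) Z = snd (LC q c) Z'"
  then have "Z \<in> fst (VC c)" "Z' \<in> fst (VC c)" "snd (VC c) Z = snd (VC c) Z'"
    using assms by (simp_all add: in_leaf in_VC snd_LC) (simp add: snd_VC)
  then show "Z = Z'" using inj_onD[OF inj_VC[OF assms(1)]] by blast
qed

lemma vpoint_leaf: "c \<in> A \<Longrightarrow> q \<in> fst c \<Longrightarrow> vpoint c q u \<in> leaf A q"
  by (simp add: in_leaf vpoint)

lemma LC_range:
  assumes "c \<in> A" "q \<in> fst c"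
  shows "snd (LC q c) ` leaf A q = UNIV"
proof -
  have "u \<in> snd (LC q c) ` leaf A q" for u
    by (rule image_eqI[OF _ vpoint_leaf[OF assms, of u]]) (simp add: snd_LC vpoint assms)
  then show ?thesis by blast
qed

lemma cinv_LC:
  assumes "c \<in> A" "q \<in> fst c"
  shows "cinv (LC q c) u = vpoint c q u"
  using assms by (intro cinv_eqI) (simp_all add: fst_LC inj_LC vpoint_leaf snd_LC vpoint)

text \<open>Every leaf chart maps the leaf onto the whole model space, so this linear formula holds
  globally, and the smoothness of the leaf atlas follows from it.\<close>

lemma LC_transition:
  assumes "c \<in> A" "q \<in> fst c" "d \<in> A" "q \<in> fst d"
  shows "snd (LC q d) \<circ> cinv (LC q c) = (\<lambda>u. (jac c d q (fst u), jac c d q (snd u)))"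
  using assms by (simp add: fun_eq_iff cinv_LC snd_LC snd_VC_vpoint)

lemma bounded_linear_jac_pair:
  assumes "c \<in> A" "q \<in> fst c" "d \<in> A" "q \<in> fst d"
  shows "bounded_linear (\<lambda>u. (jac c d q (fst u), jac c d q (snd u)))"
proof -
  have "bounded_linear (jac c d q)"
    using linear_jac[OF assms(1,3,2,4)] by (simp add: linear_conv_bounded_linear)
  then show ?thesis
    by (intro bounded_linear_Pair bounded_linear_compose[OF _ bounded_linear_fst]
        bounded_linear_compose[OF _ bounded_linear_snd])
qed

lemma smooth_atlas_leaf: "smooth_atlas (leaf_atlas A q)"
  unfolding smooth_atlas_def leaf_atlas_def ball_simps
  by (intro conjI ballI)
    (auto simp: fst_LC inj_LC LC_range LC_transition simp del: o_apply
      intro!: smooth_on_linear bounded_linear_jac_pair)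

lemma carrier_of_leaf: "q \<in> carrier_of A \<Longrightarrow> carrier_of (leaf_atlas A q) = leaf A q"
  by (auto simp: carrier_of_def leaf_atlas_def fst_LC)

lemma jac_LC:
  assumes "c \<in> A" "q \<in> fst c" "d \<in> A" "q \<in> fst d"
  shows "jac (LC q c) (LC q d) Z u = (jac c d q (fst u), jac c d q (snd u))"
  unfolding jac_def[of "LC q c"] LC_transition[OF assms]
  using bounded_linear_imp_has_derivative[OF bounded_linear_jac_pair[OF assms], THEN frechet_derivative_at]
  by metis

sublocale L: atlas "leaf_atlas A q" for q
  by unfold_locales (rule smooth_atlas_leaf)

text \<open>In the charts of one c the inclusion is u to (x(q), u), whose derivative inserts a zero
  base component. The source chart \<open>b\<close> is arbitrary because of the choice inside
  \<open>tangent_map\<close>, and the target chart \<open>d\<close> because a tangent vector is a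
  family over all charts.\<close>

lemma tangent_map_leaf_inclusion:
  assumes "Z \<in> leaf A q" "v \<in> tangent_space (leaf_atlas A q) Z" "c \<in> A" "q \<in> fst c"
  shows "tangent_map (leaf_atlas A q) (vertical_atlas A) (\<lambda>Z. Z) Z v =
    tvec_of (vertical_atlas A) (VC c) Z (0, v (LC q c))"
proof
  fix D
  have Z: "Z \<in> vertical_bundle A" "vproj Z = q" using assms(1) by (simp_all add: in_leaf)
  show "tangent_map (leaf_atlas A q) (vertical_atlas A) (\<lambda>Z. Z) Z v D =
    tvec_of (vertical_atlas A) (VC c) Z (0, v (LC q c)) D"
  proof (cases "D \<in> vertical_atlas A \<and> Z \<in> fst D")
    case True
    then obtain d where d: "d \<in> A" "D = VC d" "q \<in> fst d"
      using Z by (auto simp: vertical_atlas_def in_VC)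
    have jac: "(jac b d q (fst (v (LC q b))), jac b d q (snd (v (LC q b)))) = v (LC q d)"
      if "b \<in> A" "q \<in> fst b" for b
      using L.tangent_space_jac[OF assms(2) LC_in[OF that] LC_in[OF d(1,3)]]
        jac_LC[OF that d(1,3), of Z "v (LC q b)"] assms(1) by (simp add: fst_LC)
    have "tangent_map (leaf_atlas A q) (vertical_atlas A) (\<lambda>Z. Z) Z v D = (0, v (LC q d))"
    proof (rule L.tangent_map_eqI)
      fix B assume "B \<in> leaf_atlas A q" "Z \<in> fst B"
      then obtain b where b: "B = LC q b" "b \<in> A" "q \<in> fst b" by (auto simp: leaf_atlas_def)
      have "snd D \<circ> (\<lambda>Z. Z) \<circ> cinv B = (\<lambda>u. (snd d q, jac b d q (fst u), jac b d q (snd u)))"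
        using b d by (simp add: fun_eq_iff cinv_LC snd_VC_vpoint)
      moreover have "((\<lambda>u. (snd d q, jac b d q (fst u), jac b d q (snd u))) has_derivative
          (\<lambda>u. (0, jac b d q (fst u), jac b d q (snd u)))) (at (snd B Z))"
        by (intro has_derivative_Pair[OF has_derivative_const] bounded_linear_imp_has_derivative
            bounded_linear_jac_pair b d)
      ultimately have "frechet_derivative (snd D \<circ> (\<lambda>Z. Z) \<circ> cinv B) (at (snd B Z)) =
          (\<lambda>u. (0, jac b d q (fst u), jac b d q (snd u)))"
        by (simp only: frechet_derivative_at[symmetric])
      then show "frechet_derivative (snd D \<circ> (\<lambda>Z. Z) \<circ> cinv B) (at (snd B Z)) (v B) = (0, v (LC q d))"
        using jac[OF b(2,3)] b(1) by simp
    next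
      show "Z \<in> carrier_of (leaf_atlas A q)"
        using assms by (subst carrier_of_leaf) (auto simp: carrier_of_def)
    qed (use True in auto)
    also have "\<dots> = tvec_of (vertical_atlas A) (VC c) Z (0, v (LC q c)) D"
      using True d jac[OF assms(3,4)] jac_VC_vertical[OF assms(3) d(1) Z(1)] Z assms(4)
      by (simp add: V.tvec_of_apply)
    finally show ?thesis .
  qed (auto simp: tangent_map_def V.tvec_of_apply)
qed

end

section \<open>Tangent metrics along the fibres\<close>

lemma bilinear_linear:
  assumes "bilinear h"
  shows "linear (\<lambda>x. h x y)" "linear (\<lambda>y. h x y)"
  using assms unfolding bilinear_def by blast+

lemma bilinear_compose:
  assumes "bilinear h" "linear f" "linear g"
  shows "bilinear (\<lambda>x y. h (f x) (g y))"
  unfolding bilinear_def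
  using linear_compose[OF assms(2) bilinear_linear(1)[OF assms(1)]]
    linear_compose[OF assms(3) bilinear_linear(2)[OF assms(1)]] by (simp add: o_def)

lemma linear_Pair_0: "linear (\<lambda>b. (0, b))"
  by (simp add: linear_iff)

text \<open>The Riesz representation for a form that may be indefinite: t to h t is injective by
  non-degeneracy, hence onto the dual in finite dimension.\<close>

lemma nondegenerate_bilinear_represents:
  fixes h :: "'e::euclidean_space \<Rightarrow> 'e \<Rightarrow> real"
  assumes "bilinear h" "\<And>a. (\<And>b. h a b = 0) \<Longrightarrow> a = 0" "linear f"
  shows "\<exists>t. \<forall>b. h t b = f b"
proof -
  note hl = bilinear_linear(1)[OF assms(1)] and hr = bilinear_linear(2)[OF assms(1)]
  let ?F = "\<lambda>t. \<Sum>e\<in>Basis. h t e *\<^sub>R e"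
  have F: "?F t \<bullet> e = h t e" if "e \<in> Basis" for t e
    using that by (simp add: inner_sum_left_Basis)
  have lin: "linear ?F"
    by (simp add: linear_iff linear_add[OF hl] linear_cmul[OF hl] scaleR_add_left sum.distrib
        scaleR_sum_right)
  have "inj ?F"
    unfolding linear_injective_0[OF lin]
  proof (intro allI impI)
    fix t assume "?F t = 0"
    then have "h t e = 0" if "e \<in> Basis" for e using F[OF that, of t] by simp
    then have "h t = (\<lambda>b. 0)" by (intro linear_eq_stdbasis hr linear_zero) auto
    then show "t = 0" by (intro assms(2)) simp
  qed
  then have "surj ?F" by (rule linear_inj_imp_surj[OF lin])
  from surjD[OF this, of "\<Sum>e\<in>Basis. f e *\<^sub>R e"]
  obtain t where t: "(\<Sum>e\<in>Basis. f e *\<^sub>R e) = ?F t" ..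
  have "h t e = f e" if "e \<in> Basis" for e
    using F[OF that, of t] that unfolding t[symmetric] by (simp add: inner_sum_left_Basis)
  then have "h t = f" by (intro linear_eq_stdbasis hr assms(3)) auto
  then show ?thesis by blast
qed

lemma frechet_derivative_cong_open:
  assumes "(f has_derivative f') (at x)" "open S" "x \<in> S" "\<And>u. u \<in> S \<Longrightarrow> f u = g u"
  shows "frechet_derivative g (at x) = f'"
  by (rule frechet_derivative_at[symmetric, OF has_derivative_transform_within_open[OF assms]])

locale tangent_metric_manifold = manifold_atlas A
  for A :: "('a, real^'m::finite) chart set" +
  fixes \<gamma> :: "('a, 'm) metric_TM"
  assumes tangent_metric: "tangent_metric A \<gamma>"
begin

text \<open>The form \<open>g_ij a^i b^j\<close>, but read off on vertical vectors, where neither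
  horizontal lifts nor the coefficients \<open>t_i^j\<close> are involved.\<close>

definition fform :: "('a, real^'m) chart \<Rightarrow> ('a, 'm) tpt \<Rightarrow> real^'m \<Rightarrow> real^'m \<Rightarrow> real" where
  "fform c \<xi> a b = \<gamma> \<xi> (vlift c \<xi> a) (vlift c \<xi> b)"

lemma pseudo_riemannian_\<gamma>: "pseudo_riemannian (tangent_atlas A) \<gamma>"
  using tangent_metric by (simp add: tangent_metric_def)

lemma \<gamma>_bilinear_on:
  "\<xi> \<in> tangent_bundle A \<Longrightarrow> bilinear_on (tangent_space (tangent_atlas A) \<xi>) (\<gamma> \<xi>)"
  using pseudo_riemannian_\<gamma> by (simp add: pseudo_riemannian_def carrier_of_TC)

lemma \<gamma>_sym:
  "\<xi> \<in> tangent_bundle A \<Longrightarrow> v \<in> tangent_space (tangent_atlas A) \<xi> \<Longrightarrow>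
    w \<in> tangent_space (tangent_atlas A) \<xi> \<Longrightarrow> \<gamma> \<xi> v w = \<gamma> \<xi> w v"
  using pseudo_riemannian_\<gamma> by (simp add: pseudo_riemannian_def carrier_of_TC)

context
  fixes \<xi> c assumes \<xi>: "\<xi> \<in> tangent_bundle A" and c: "c \<in> A" "fst \<xi> \<in> fst c"
begin

lemma TC_point: "TC c \<in> tangent_atlas A" "\<xi> \<in> fst (TC c)"
  using \<xi> c by (simp_all add: TC_in in_TC)

lemma bilinear_\<gamma>:
  "bilinear (\<lambda>a b. \<gamma> \<xi> (tvec_of (tangent_atlas A) (TC c) \<xi> a) (tvec_of (tangent_atlas A) (TC c) \<xi> b))"
  by (rule T.bilinear_tvec_of[OF TC_point \<gamma>_bilinear_on[OF \<xi>]])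

lemma bilinear_fform: "bilinear (fform c \<xi>)"
  unfolding fform_def[abs_def] by (rule bilinear_compose[OF bilinear_\<gamma> linear_Pair_0 linear_Pair_0])

lemma fform_sym: "fform c \<xi> a b = fform c \<xi> b a"
  unfolding fform_def by (intro \<gamma>_sym \<xi> vlift_in c)

lemma fform_nondegenerate:
  assumes "\<And>b. fform c \<xi> a b = 0"
  shows "a = 0"
proof -
  have "nondegenerate_on (vertical A \<xi>) (\<gamma> \<xi>)"
    using tangent_metric \<xi> by (simp add: tangent_metric_def)
  moreover have "\<gamma> \<xi> (vlift c \<xi> a) w = 0" if "w \<in> vertical A \<xi>" for w
    using vertical_vlift[OF \<xi> c that] assms[of "snd (w (TC c))"] by (simp add: fform_def)
  ultimately have "vlift c \<xi> a = (\<lambda>c. 0)"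
    using vlift_vertical[OF \<xi> c] unfolding nondegenerate_on_def by blast
  then show "a = 0" using vlift_self[OF \<xi> c, of a] by (simp add: zero_prod_def)
qed

lemma fform_transition:
  assumes "d \<in> A" "fst \<xi> \<in> fst d"
  shows "fform d \<xi> (jac c d (fst \<xi>) a) (jac c d (fst \<xi>) b) = fform c \<xi> a b"
proof -
  have "vlift d \<xi> (jac c d (fst \<xi>) a) = vlift c \<xi> a" for a
    using assms \<xi> c
    by (intro T.tangent_space_eqI[of "TC d" \<xi>] vlift_in)
      (simp_all add: vlift_self vlift_jac TC_in in_TC)
  then show ?thesis by (simp add: fform_def)
qed

text \<open>S is given chart by chart and thus could depend on the chart; it does not, because the
  base components of X and the components of a vertical vector transform by the same
  Jacobian.\<close>

lemma tangent_structure_vlift: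
  assumes "X \<in> tangent_space (tangent_atlas A) \<xi>"
  shows "tangent_structure X = vlift c \<xi> (fst (X (TC c)))"
proof
  fix D
  show "tangent_structure X D = vlift c \<xi> (fst (X (TC c))) D"
  proof (cases "D \<in> tangent_atlas A \<and> \<xi> \<in> fst D")
    case True
    then obtain d where d: "d \<in> A" "D = TC d" "fst \<xi> \<in> fst d" using in_tangent_atlas by metis
    have "jac (TC c) (TC d) \<xi> (X (TC c)) = X (TC d)"
      using assms TC_point True d by (intro T.tangent_space_jac) auto
    then show ?thesis
      using d vlift_jac[OF \<xi> c d(1,3)] fst_jac_TC[OF c(1) d(1) \<xi> c(2) d(3), of "X (TC c)"]
      by (simp add: tangent_structure_def)
  next
    case False
    then have "X D = 0" using assms unfolding T.tangent_space_iff by blast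
    with False show ?thesis by (auto simp: tangent_structure_def T.tvec_of_apply zero_prod_def)
  qed
qed

lemma horizontal_iff:
  assumes "X \<in> tangent_space (tangent_atlas A) \<xi>"
  shows "X \<in> horizontal A \<gamma> \<xi> \<longleftrightarrow> (\<forall>b. \<gamma> \<xi> X (vlift c \<xi> b) = 0)"
proof
  assume "X \<in> horizontal A \<gamma> \<xi>"
  then show "\<forall>b. \<gamma> \<xi> X (vlift c \<xi> b) = 0"
    using vlift_vertical[OF \<xi> c] by (simp add: horizontal_def)
next
  assume *: "\<forall>b. \<gamma> \<xi> X (vlift c \<xi> b) = 0"
  have "\<gamma> \<xi> X w = 0" if "w \<in> vertical A \<xi>" for w
    by (subst vertical_vlift[OF \<xi> c that]) (rule *[rule_format])
  with assms show "X \<in> horizontal A \<gamma> \<xi>" by (simp add: horizontal_def)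
qed

text \<open>Makes the \<open>THE\<close> in \<open>hlift\<close> meaningful. A vector with
  components (a, t) is horizontal iff \<open>fform c \<xi> t b\<close> is minus the pairing of (a,
  0) with (0, b) for all b. Non-degeneracy on the vertical space solves this uniquely for t, whose
  components for a = \<open>axis i 1\<close> are the numbers \<open>- t_i^j\<close>.\<close>

lemma ex1_hlift: "\<exists>!X. X \<in> horizontal A \<gamma> \<xi> \<and> fst (X (TC c)) = a"
proof -
  let ?t = "tvec_of (tangent_atlas A) (TC c) \<xi>"
  let ?B = "\<lambda>a b. \<gamma> \<xi> (?t a) (?t b)"
  have in_T: "?t v \<in> tangent_space (tangent_atlas A) \<xi>" for v by (rule T.tvec_of_in[OF TC_point])
  note l1 = bilinear_linear(1)[OF bilinear_\<gamma>] and l2 = bilinear_linear(2)[OF bilinear_\<gamma>]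
  from linear_compose[OF linear_Pair_0 l2, of "(a, 0)"]
  have "linear (\<lambda>b. - ?B (a, 0) (0, b))" by (intro linear_compose_neg) (simp add: o_def)
  then have "\<exists>t. \<forall>b. fform c \<xi> t b = - ?B (a, 0) (0, b)"
    by (intro nondegenerate_bilinear_represents[OF bilinear_fform]) (rule fform_nondegenerate)
  then obtain t where t: "\<And>b. fform c \<xi> t b = - ?B (a, 0) (0, b)" by blast
  have split: "?B (a, s) (0, b) = ?B (a, 0) (0, b) + fform c \<xi> s b" for s b
    using linear_add[OF l1, of "(a, 0)" "(0, s)"] by (simp add: fform_def)
  show ?thesis
  proof (rule ex1I[of _ "?t (a, t)"])
    show "?t (a, t) \<in> horizontal A \<gamma> \<xi> \<and> fst (?t (a, t) (TC c)) = a"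
    proof -
      have "?B (a, t) (0, b) = 0" for b unfolding split[of t b] t[of b] by simp
      then show ?thesis by (simp add: horizontal_iff[OF in_T] T.tvec_of_self[OF TC_point])
    qed
    fix X assume X: "X \<in> horizontal A \<gamma> \<xi> \<and> fst (X (TC c)) = a"
    then have XT: "X \<in> tangent_space (tangent_atlas A) \<xi>" by (simp add: horizontal_def)
    define s where "s = snd (X (TC c))"
    have Xs: "X = ?t (a, s)"
    proof -
      have "X (TC c) = (a, s)" using X by (simp add: prod_eq_iff s_def)
      then show ?thesis using T.tvec_of_component[OF TC_point XT] by simp
    qed
    note lf = bilinear_linear(1)[OF bilinear_fform]
    have "fform c \<xi> (s - t) b = 0" for b
    proof -
      have "?B (a, s) (0, b) = 0" using X horizontal_iff[OF XT] unfolding Xs by blast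
      then show ?thesis using split[of s b] t[of b] unfolding linear_diff[OF lf] by linarith
    qed
    then have "s = t" using fform_nondegenerate[of "s - t"] by simp
    with Xs show "X = ?t (a, t)" by simp
  qed
qed

text \<open>S maps the horizontal lift of d/dx^i to d/dy^i, and the defining property of a tangent
  metric says that S preserves \<gamma> on horizontal vectors.\<close>

lemma gcomp_eq_fform: "gcomp A \<gamma> c i j \<xi> = fform c \<xi> (axis i 1) (axis j 1)"
proof -
  have H: "hlift A \<gamma> c i \<xi> \<in> horizontal A \<gamma> \<xi>" "fst (hlift A \<gamma> c i \<xi> (TC c)) = axis i 1" for i
    using theI'[OF ex1_hlift[of "axis i 1"]] unfolding hlift_def by blast+
  then have S: "tangent_structure (hlift A \<gamma> c i \<xi>) = vlift c \<xi> (axis i 1)" for i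
    using tangent_structure_vlift[of "hlift A \<gamma> c i \<xi>"] by (simp add: horizontal_def)
  have "gcomp A \<gamma> c i j \<xi> =
      \<gamma> \<xi> (tangent_structure (hlift A \<gamma> c i \<xi>)) (tangent_structure (hlift A \<gamma> c j \<xi>))"
    using tangent_metric \<xi> H unfolding gcomp_def tangent_metric_def by metis
  then show ?thesis by (simp add: S fform_def)
qed

end

text \<open>The same form as a function of the coordinates (x, y), ready to be differentiated with a
  and b held constant.\<close>

definition gform :: "('a, real^'m) chart \<Rightarrow> real^'m \<Rightarrow> real^'m \<Rightarrow> (real^'m) \<times> (real^'m) \<Rightarrow> real" where
  "gform c a b u = fform c (cinv (TC c) u) a b"

lemma smooth_on_gform:
  assumes "c \<in> A"
  shows "smooth_on (snd c ` fst c \<times> UNIV) (gform c a b)"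
proof -
  have "smooth_on (snd (TC c) ` fst (TC c)) (local_rep (tangent_atlas A) \<gamma> (TC c) (0, a) (0, b))"
    using pseudo_riemannian_\<gamma> TC_in[OF assms] by (simp add: pseudo_riemannian_def)
  then show ?thesis
    by (simp add: TC_range[OF assms] gform_def[abs_def] fform_def local_rep_def[abs_def])
qed

lemma cinv_TC_point:
  assumes "c \<in> A" "u \<in> snd c ` fst c \<times> UNIV"
  shows "cinv (TC c) u \<in> tangent_bundle A" "fst (cinv (TC c) u) \<in> fst c"
  using cinv_in[of u "TC c"] TC_range[OF assms(1)] assms(2) by (simp_all add: in_TC)

lemma bilinear_gform:
  assumes "c \<in> A" "u \<in> snd c ` fst c \<times> UNIV"
  shows "bilinear (\<lambda>a b. gform c a b u)"
  using bilinear_fform[OF cinv_TC_point(1)[OF assms] assms(1) cinv_TC_point(2)[OF assms]]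
  by (simp add: gform_def)

lemma gform_sym:
  assumes "c \<in> A" "u \<in> snd c ` fst c \<times> UNIV"
  shows "gform c a b u = gform c b a u"
  using fform_sym[OF cinv_TC_point(1)[OF assms] assms(1) cinv_TC_point(2)[OF assms]]
  by (simp add: gform_def)

lemma open_TC_range: "c \<in> A \<Longrightarrow> open (snd c ` fst c \<times> (UNIV :: (real^'m) set))"
  by (intro open_Times chart_open open_UNIV)

text \<open>The trilinear form \<open>k^l a^i b^j dg_ij/dy^l\<close>, which is the Cartan tensor of
  Finsler geometry up to the factor 1/2.\<close>

definition Dg :: "('a, real^'m) chart \<Rightarrow> (real^'m) \<times> (real^'m) \<Rightarrow> real^'m \<Rightarrow> real^'m \<Rightarrow> real^'m \<Rightarrow> real"
  where "Dg c u k a b = frechet_derivative (gform c a b) (at u) (0, k)"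

lemma gform_has_derivative:
  assumes "c \<in> A" "u \<in> snd c ` fst c \<times> UNIV"
  shows "(gform c a b has_derivative frechet_derivative (gform c a b) (at u)) (at u)"
  by (rule smooth_on_has_derivative[OF smooth_on_gform[OF assms(1)] assms(2)])

lemma Dg_sym:
  assumes "c \<in> A" "u \<in> snd c ` fst c \<times> UNIV"
  shows "Dg c u k a b = Dg c u k b a"
  unfolding Dg_def
  by (subst frechet_derivative_cong_open[OF gform_has_derivative[OF assms] open_TC_range[OF assms(1)]
      assms(2) gform_sym[OF assms(1)]]) simp_all

text \<open>The pivot of the equivalence. Together with the symmetry of g in its two arguments,
  exchanging k and a generates all permutations, so \<open>Dg\<close> is totally symmetric over
  \<open>q\<close>.\<close>

definition fibre_symmetric :: "'a \<Rightarrow> bool" where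
  "fibre_symmetric q \<longleftrightarrow>
    (\<forall>c\<in>A. q \<in> fst c \<longrightarrow> (\<forall>y k a b. Dg c (snd c q, y) k a b = Dg c (snd c q, y) a k b))"

text \<open>Linearity in k is that of a derivative. Linearity in a comes from differentiating the
  bilinearity of g, valid on an open set, and linearity in b follows by symmetry.\<close>

lemma Dg_linear:
  assumes "c \<in> A" "u \<in> snd c ` fst c \<times> UNIV"
  shows "linear (\<lambda>k. Dg c u k a b)" "linear (\<lambda>a. Dg c u k a b)" "linear (\<lambda>b. Dg c u k a b)"
proof -
  from linear_compose[OF linear_Pair_0 has_derivative_linear[OF gform_has_derivative[OF assms]]]
  show "linear (\<lambda>k. Dg c u k a b)" by (simp add: Dg_def[abs_def] o_def)
  have bil: "gform c (r *\<^sub>R a + s *\<^sub>R a') b w = r * gform c a b w + s * gform c a' b w"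
    if "w \<in> snd c ` fst c \<times> UNIV" for r s a a' b w
  proof -
    note l = bilinear_linear(1)[OF bilinear_gform[OF assms(1) that]]
    show ?thesis by (simp add: linear_add[OF l] linear_cmul[OF l])
  qed
  have "((\<lambda>w. r * gform c a b w + s * gform c a' b w) has_derivative
      (\<lambda>v. r * frechet_derivative (gform c a b) (at u) v + s * frechet_derivative (gform c a' b) (at u) v))
      (at u)" for r s a a' b
    by (intro has_derivative_add has_derivative_mult_right gform_has_derivative assms)
  from frechet_derivative_cong_open[OF this open_TC_range[OF assms(1)] assms(2) bil[symmetric]]
  have D: "Dg c u k (r *\<^sub>R a + s *\<^sub>R a') b = r * Dg c u k a b + s * Dg c u k a' b" for r s a a' b
    unfolding Dg_def by simp
  from D[of 1 _ 1] D[of _ _ 0] show l: "linear (\<lambda>a. Dg c u k a b)" for b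
    by (simp add: linear_iff)
  show "linear (\<lambda>b. Dg c u k a b)" using l by (simp add: Dg_sym[OF assms, of k a])
qed

end

section \<open>The metric of the leaves\<close>

lemma basis_axis:
  assumes "i \<in> (Basis :: (real^'m::finite) set)"
  obtains k where "i = axis k 1"
  using assms by (auto simp: Basis_vec_def)

locale extension_manifold = tangent_metric_manifold A \<gamma>
  for A :: "('a, real^'m::finite) chart set" and \<gamma> :: "('a, 'm) metric_TM" +
  fixes G :: "('a, 'm) metric_TV"
  assumes is_extension: "is_extension A \<gamma> G"
begin

text \<open>\<open>is_extension\<close> prescribes G only on the coordinate fields d/dy^i and
  d/d\<eta>^i; the values on all leaf directions follow block by block, as bilinear forms agreeing
  on a basis are equal.\<close>

lemma G_vertical:
  assumes "Z \<in> vertical_bundle A" "c \<in> A" "vproj Z \<in> fst c"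
  shows "G Z (tvec_of (vertical_atlas A) (VC c) Z (0, u)) (tvec_of (vertical_atlas A) (VC c) Z (0, w)) =
    fform c (fst Z) (fst u) (fst w) + fform c (fst Z) (snd u) (snd w)"
proof -
  let ?t = "\<lambda>a b. tvec_of (vertical_atlas A) (VC c) Z (0, a, b)"
  have Z: "fst Z \<in> tangent_bundle A" "fst (fst Z) \<in> fst c"
    using assms by (simp_all add: vertical_bundle_iff vproj_def)
  have VC: "VC c \<in> vertical_atlas A" "Z \<in> fst (VC c)" using assms by (simp_all add: VC_in in_VC)
  have pr: "pseudo_riemannian (vertical_atlas A) G"
    using is_extension by (simp add: is_extension_def)
  have bG: "bilinear_on (tangent_space (vertical_atlas A) Z) (G Z)"
    using pr assms(1) by (simp add: pseudo_riemannian_def carrier_of_VC)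
  note bil = V.bilinear_tvec_of[OF VC bG]
  note bilG = bilinear_compose[OF bil linear_Pair_0 linear_Pair_0]
  note fbil = bilinear_fform[OF Z(1) assms(2) Z(2)]
  have comp: "G Z (?t (axis i 1) 0) (?t (axis j 1) 0) = fform c (fst Z) (axis i 1) (axis j 1)"
    "G Z (?t 0 (axis i 1)) (?t 0 (axis j 1)) = fform c (fst Z) (axis i 1) (axis j 1)"
    "G Z (?t (axis i 1) 0) (?t 0 (axis j 1)) = 0" for i j
    using is_extension assms gcomp_eq_fform[OF Z(1) assms(2) Z(2)]
    by (simp_all add: is_extension_def d_dy_def d_deta_def)
  have l1: "linear (\<lambda>a::real^'m. (a, 0::real^'m))" and l2: "linear (\<lambda>a::real^'m. (0::real^'m, a))"
    by (simp_all add: linear_iff)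
  have 1: "(\<lambda>a b. G Z (?t a 0) (?t b 0)) = fform c (fst Z)"
    by (rule bilinear_eq_stdbasis[OF bilinear_compose[OF bilG l1 l1] fbil])
      (auto elim!: basis_axis simp: comp)
  have 2: "(\<lambda>a b. G Z (?t 0 a) (?t 0 b)) = fform c (fst Z)"
    by (rule bilinear_eq_stdbasis[OF bilinear_compose[OF bilG l2 l2] fbil])
      (auto elim!: basis_axis simp: comp)
  have "bilinear (\<lambda>(a::real^'m) (b::real^'m). 0 :: real)" by (simp add: bilinear_def linear_zero)
  then have 3: "(\<lambda>a b. G Z (?t a 0) (?t 0 b)) = (\<lambda>a b. 0)"
    by (rule bilinear_eq_stdbasis[OF bilinear_compose[OF bilG l1 l2]])
      (auto elim!: basis_axis simp: comp)
  \<comment> \<open>The orthogonality clause is stated for the order d/dy, d/d\<eta>; the other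
    order needs the symmetry of G.\<close>
  have 4: "G Z (?t 0 a) (?t b 0) = 0" for a b
  proof -
    have "G Z (?t 0 a) (?t b 0) = G Z (?t b 0) (?t 0 a)"
      using pr assms(1) V.tvec_of_in[OF VC] by (simp add: pseudo_riemannian_def carrier_of_VC)
    then show ?thesis using fun_cong[OF fun_cong[OF 3]] by simp
  qed
  have s: "u = (fst u, 0) + (0, snd u)" for u :: "(real^'m) \<times> (real^'m)" by simp
  note la = linear_add[OF bilinear_linear(1)[OF bilG]] and ra = linear_add[OF bilinear_linear(2)[OF bilG]]
  have "G Z (tvec_of (vertical_atlas A) (VC c) Z (0, u)) (tvec_of (vertical_atlas A) (VC c) Z (0, w)) =
     G Z (?t (fst u) 0) (?t (fst w) 0) + G Z (?t (fst u) 0) (?t 0 (snd w)) +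
     (G Z (?t 0 (snd u)) (?t (fst w) 0) + G Z (?t 0 (snd u)) (?t 0 (snd w)))"
    by (subst s[of u], subst s[of w]) (simp only: la ra)
  then show ?thesis
    using fun_cong[OF fun_cong[OF 1]] fun_cong[OF fun_cong[OF 2]] fun_cong[OF fun_cong[OF 3]] 4
    by simp
qed

context
  fixes q assumes q: "q \<in> carrier_of A"
begin

abbreviation "Lm \<equiv> leaf_metric A q G"

lemma leaf_metric_eq:
  assumes "Z \<in> leaf A q" "c \<in> A" "q \<in> fst c"
    and "v \<in> tangent_space (leaf_atlas A q) Z" "w \<in> tangent_space (leaf_atlas A q) Z"
  shows "Lm Z v w = fform c (fst Z) (fst (v (LC q c))) (fst (w (LC q c)))
    + fform c (fst Z) (snd (v (LC q c))) (snd (w (LC q c)))"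
  using assms
  by (simp add: leaf_metric_def tangent_map_leaf_inclusion[of _ q _ c] G_vertical in_leaf)

lemma leaf_point:
  assumes "Z \<in> leaf A q" "c \<in> A" "q \<in> fst c"
  shows "fst Z \<in> tangent_bundle A" "fst (fst Z) \<in> fst c" "LC q c \<in> leaf_atlas A q" "Z \<in> fst (LC q c)"
  using assms by (simp_all add: in_leaf vertical_bundle_iff vproj_def LC_in fst_LC)

lemma obtain_chart:
  obtains c where "c \<in> A" "q \<in> fst c"
  using q by (auto simp: carrier_of_def)

lemma in_leaf_atlas:
  assumes "C \<in> leaf_atlas A q"
  obtains c where "c \<in> A" "q \<in> fst c" "C = LC q c"
  using assms by (auto simp: leaf_atlas_def)

text \<open>The rotation (y, \<eta>) to (-\<eta>, y) commutes with a linear map that acts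
  identically on both factors, as the coordinate changes of a leaf do.\<close>

lemma leaf_J_in:
  assumes "Z \<in> leaf A q" "v \<in> tangent_space (leaf_atlas A q) Z"
  shows "leaf_J Z v \<in> tangent_space (leaf_atlas A q) Z"
  unfolding L.tangent_space_iff
proof (intro conjI ballI allI impI)
  fix C D assume "C \<in> leaf_atlas A q" "D \<in> leaf_atlas A q" "Z \<in> fst C \<and> Z \<in> fst D"
  then obtain c d where c: "c \<in> A" "q \<in> fst c" "C = LC q c" and d: "d \<in> A" "q \<in> fst d" "D = LC q d"
    by (metis in_leaf_atlas)
  have "v D = (jac c d q (fst (v C)), jac c d q (snd (v C)))"
    using L.tangent_space_jac[OF assms(2), of C D] jac_LC[OF c(1,2) d(1,2), of Z "v C"]
      leaf_point[OF assms(1)] c d by simp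
  moreover have "jac c d q (- a) = - jac c d q a" for a
    using linear_neg[OF linear_jac[OF c(1) d(1) c(2) d(2)]] .
  ultimately show "leaf_J Z v D = jac C D Z (leaf_J Z v C)"
    using jac_LC[OF c(1,2) d(1,2), of Z "leaf_J Z v C"] by (simp add: leaf_J_def c(3) d(3))
next
  fix C assume "\<not> (C \<in> leaf_atlas A q \<and> Z \<in> fst C)"
  then have "v C = 0" using assms(2) unfolding L.tangent_space_iff by blast
  then show "leaf_J Z v C = 0" by (simp add: leaf_J_def zero_prod_def)
qed

lemma complex_structure_leaf: "complex_structure (leaf_atlas A q) leaf_J"
  unfolding complex_structure_def carrier_of_leaf[OF q]
proof (intro conjI ballI)
  fix Z v assume "Z \<in> leaf A q" "v \<in> tangent_space (leaf_atlas A q) Z"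
  then show "leaf_J Z v \<in> tangent_space (leaf_atlas A q) Z" by (rule leaf_J_in)
  show "leaf_J Z (leaf_J Z v) = (\<lambda>c. - v c)" by (simp add: leaf_J_def fun_eq_iff prod_eq_iff)
next
  fix Z assume Z: "Z \<in> leaf A q"
  obtain c where c: "c \<in> A" "q \<in> fst c" by (rule obtain_chart)
  \<comment> \<open>Multiplication by the imaginary unit in the coordinates y + i \<eta>. The leaf
    chart itself is the compatible chart required, since \<open>leaf_J\<close> is constant in
    it.\<close>
  define K :: "(real^'m) \<times> (real^'m) \<Rightarrow> (real^'m) \<times> (real^'m)" where "K = (\<lambda>u. (- snd u, fst u))"
  show "\<exists>C K. smooth_atlas (insert C (leaf_atlas A q)) \<and> Z \<in> fst C \<and> fst C \<subseteq> leaf A q \<and> linear K \<and>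
      (\<forall>q'\<in>fst C. \<forall>D\<in>leaf_atlas A q. q' \<in> fst D \<longrightarrow> (\<forall>v\<in>tangent_space (leaf_atlas A q) q'.
        frechet_derivative (snd C \<circ> cinv D) (at (snd D q')) (leaf_J q' v D) =
        K (frechet_derivative (snd C \<circ> cinv D) (at (snd D q')) (v D))))"
  proof (intro exI[of _ "LC q c"] exI[of _ K] conjI ballI impI)
    show "smooth_atlas (insert (LC q c) (leaf_atlas A q))"
      using LC_in[OF c] smooth_atlas_leaf by (simp add: insert_absorb)
    show "Z \<in> fst (LC q c)" "fst (LC q c) \<subseteq> leaf A q" using Z by (simp_all add: fst_LC)
    show "linear K" by (simp add: K_def linear_iff)
    fix Z' D v assume Z': "Z' \<in> fst (LC q c)" and D: "D \<in> leaf_atlas A q" "Z' \<in> fst D"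
      and v: "v \<in> tangent_space (leaf_atlas A q) Z'"
    have "leaf_J Z' v \<in> tangent_space (leaf_atlas A q) Z'"
      using Z' v by (intro leaf_J_in) (simp_all add: fst_LC)
    from L.tangent_space_jac[OF this D(1) LC_in[OF c] D(2) Z']
      L.tangent_space_jac[OF v D(1) LC_in[OF c] D(2) Z']
    show "frechet_derivative (snd (LC q c) \<circ> cinv D) (at (snd D Z')) (leaf_J Z' v D) =
        K (frechet_derivative (snd (LC q c) \<circ> cinv D) (at (snd D Z')) (v D))"
      by (simp add: jac_def leaf_J_def K_def)
  qed
qed

lemma leaf_metric_J:
  assumes "Z \<in> leaf A q" "v \<in> tangent_space (leaf_atlas A q) Z" "w \<in> tangent_space (leaf_atlas A q) Z"
  shows "Lm Z (leaf_J Z v) (leaf_J Z w) = Lm Z v w"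
proof -
  obtain c where c: "c \<in> A" "q \<in> fst c" by (rule obtain_chart)
  note p = leaf_point[OF assms(1) c]
  note l = bilinear_linear[OF bilinear_fform[OF p(1) c(1) p(2)]]
  show ?thesis
    using assms c leaf_J_in
    by (simp add: leaf_metric_eq[of Z c] leaf_J_def linear_neg[OF l(1)] linear_neg[OF l(2)])
qed

lemma fst_vpoint:
  assumes "c \<in> A" "q \<in> fst c"
  shows "fst (vpoint c q u) = cinv (TC c) (snd c q, fst u)"
  using assms by (subst cinv_TC) (auto simp: vpoint_def cinv_apply)

lemma local_rep_leaf_metric:
  assumes "c \<in> A" "q \<in> fst c"
  shows "local_rep (leaf_atlas A q) Lm (LC q c) a b u =
    gform c (fst a) (fst b) (snd c q, fst u) + gform c (snd a) (snd b) (snd c q, fst u)"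
  unfolding local_rep_def cinv_LC[OF assms] gform_def fst_vpoint[OF assms, symmetric]
  using leaf_point[OF vpoint_leaf[OF assms] assms]
  by (simp add: leaf_metric_eq[OF vpoint_leaf[OF assms] assms] L.tvec_of_in L.tvec_of_self)

text \<open>This is \<open>g_ij\<close> times the wedge of dy^i and d\<eta>^j, evaluated on constant
  fields. Its coefficients do not involve \<eta>, so only y-derivatives enter the exterior
  derivative.\<close>

lemma local_rep_leaf_form:
  assumes "c \<in> A" "q \<in> fst c"
  shows "local_rep (leaf_atlas A q) (\<lambda>Z v w. Lm Z (leaf_J Z v) w) (LC q c) a b =
    (\<lambda>u. gform c (fst a) (snd b) (snd c q, fst u) - gform c (snd a) (fst b) (snd c q, fst u))"
proof
  fix u
  note p = leaf_point[OF vpoint_leaf[OF assms, of u] assms]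
  note l = bilinear_linear(1)[OF bilinear_fform[OF p(1) assms(1) p(2)]]
  show "local_rep (leaf_atlas A q) (\<lambda>Z v w. Lm Z (leaf_J Z v) w) (LC q c) a b u =
    gform c (fst a) (snd b) (snd c q, fst u) - gform c (snd a) (fst b) (snd c q, fst u)"
    unfolding local_rep_def cinv_LC[OF assms] gform_def fst_vpoint[OF assms, symmetric]
    using p leaf_J_in[OF vpoint_leaf[OF assms, of u]]
    by (simp add: leaf_metric_eq[OF vpoint_leaf[OF assms] assms] L.tvec_of_in)
      (simp add: leaf_J_def L.tvec_of_self linear_neg[OF l])
qed

lemma chart_slice_in: "c \<in> A \<Longrightarrow> q \<in> fst c \<Longrightarrow> (snd c q, y) \<in> snd c ` fst c \<times> UNIV"
  by simp

lemma pseudo_riemannian_leaf: "pseudo_riemannian (leaf_atlas A q) Lm"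
  unfolding pseudo_riemannian_def carrier_of_leaf[OF q]
proof (intro conjI ballI allI)
  fix Z assume Z: "Z \<in> leaf A q"
  obtain c where c: "c \<in> A" "q \<in> fst c" by (rule obtain_chart)
  note p = leaf_point[OF Z c]
  note bil = bilinear_fform[OF p(1) c(1) p(2)]
  note l = bilinear_linear[OF bil]
  note eq = leaf_metric_eq[OF Z c]
  have lc: "lincomb r u s v \<in> tangent_space (leaf_atlas A q) Z"
    if "u \<in> tangent_space (leaf_atlas A q) Z" "v \<in> tangent_space (leaf_atlas A q) Z" for u v r s
    using L.tvec_of_in[OF p(3,4)] L.tvec_of_lincomb[OF p(3,4)] L.tvec_of_component[OF p(3,4)] that
    by metis
  show "bilinear_on (tangent_space (leaf_atlas A q) Z) (Lm Z)"
    unfolding bilinear_on_def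
    by (intro ballI allI)
      (simp add: eq lc, simp add: lincomb_def linear_add[OF l(1)] linear_add[OF l(2)]
        linear_cmul[OF l(1)] linear_cmul[OF l(2)] algebra_simps)
  show "Lm Z v w = Lm Z w v"
    if "v \<in> tangent_space (leaf_atlas A q) Z" "w \<in> tangent_space (leaf_atlas A q) Z" for v w
    using that fform_sym[OF p(1) c(1) p(2)] by (simp add: eq)
  show "nondegenerate_on (tangent_space (leaf_atlas A q) Z) (Lm Z)"
    unfolding nondegenerate_on_def
  proof (intro ballI impI)
    fix v assume v: "v \<in> tangent_space (leaf_atlas A q) Z"
      and 0: "\<forall>w\<in>tangent_space (leaf_atlas A q) Z. Lm Z v w = 0"
    \<comment> \<open>Taking b in the y-factor and then in the \<eta>-factor separates the two
      summands, and each vanishes only for a zero component.\<close>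
    have e: "fform c (fst Z) (fst (v (LC q c))) (fst b) + fform c (fst Z) (snd (v (LC q c))) (snd b) = 0"
      for b
      using 0[rule_format, OF L.tvec_of_in[OF p(3,4), of b]]
      by (simp add: eq v L.tvec_of_in[OF p(3,4)] L.tvec_of_self[OF p(3,4)])
    have "fst (v (LC q c)) = 0"
      by (rule fform_nondegenerate[OF p(1) c(1) p(2)]) (use e[of "(_, 0)"] linear_0[OF l(2)] in simp)
    moreover have "snd (v (LC q c)) = 0"
      by (rule fform_nondegenerate[OF p(1) c(1) p(2)]) (use e[of "(0, _)"] linear_0[OF l(2)] in simp)
    ultimately have "v (LC q c) = 0" by (simp add: prod_eq_iff)
    then show "v = (\<lambda>c. 0)"
      using L.tvec_of_component[OF p(3,4) v] L.tvec_of_0[OF p(3,4)] by simp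
  qed
next
  fix C a b assume "C \<in> leaf_atlas A q"
  then obtain c where c: "c \<in> A" "q \<in> fst c" "C = LC q c" by (rule in_leaf_atlas)
  have "smooth_on UNIV (\<lambda>u :: (real^'m) \<times> (real^'m). gform c a b (snd c q, fst u))" for a b
  proof -
    have "bounded_linear (\<lambda>u :: (real^'m) \<times> (real^'m). (0 :: real^'m, fst u))"
      by (intro bounded_linear_Pair bounded_linear_zero bounded_linear_fst)
    from smooth_on_affine_comp[OF this open_UNIV _ smooth_on_gform[OF c(1)], of "(snd c q, 0)"]
    show ?thesis using c by simp
  qed
  then show "smooth_on (snd C ` fst C) (local_rep (leaf_atlas A q) Lm C a b)"
    unfolding c(3) local_rep_leaf_metric[OF c(1,2), abs_def] fst_LC LC_range[OF c(1,2)]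
    by (intro smooth_on_add open_UNIV)
qed

lemma leaf_form_derivative:
  assumes "c \<in> A" "q \<in> fst c"
  shows "frechet_derivative (local_rep (leaf_atlas A q) (\<lambda>Z v w. Lm Z (leaf_J Z v) w) (LC q c) a b) (at u) e
    = Dg c (snd c q, fst u) (fst e) (fst a) (snd b) - Dg c (snd c q, fst u) (fst e) (snd a) (fst b)"
proof -
  have "((\<lambda>u :: (real^'m) \<times> (real^'m). (snd c q, fst u)) has_derivative (\<lambda>e. (0, fst e))) (at u)"
    by (auto intro!: derivative_eq_intros)
  from has_derivative_compose[OF this gform_has_derivative[OF assms(1) chart_slice_in[OF assms]]]
  have d: "((\<lambda>u. gform c a b (snd c q, fst u)) has_derivative
      (\<lambda>e. frechet_derivative (gform c a b) (at (snd c q, fst u)) (0, fst e))) (at u)" for a b .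
  from frechet_derivative_at[OF has_derivative_diff[OF d d], symmetric]
  show ?thesis unfolding local_rep_leaf_form[OF assms] Dg_def by simp
qed

text \<open>Each derivative of the Kaehler form is a difference of two values of \<open>Dg\<close>.
  The exterior derivative thus has six terms, in each of which exactly one of the three vectors
  contributes its \<eta>-part.\<close>

lemma closed_leaf_form_iff:
  "closed_2form (leaf_atlas A q) (\<lambda>Z v w. Lm Z (leaf_J Z v) w) \<longleftrightarrow> fibre_symmetric q"
proof
  assume closed: "closed_2form (leaf_atlas A q) (\<lambda>Z v w. Lm Z (leaf_J Z v) w)"
  show "fibre_symmetric q"
    unfolding fibre_symmetric_def
  proof (intro ballI impI allI)
    fix c y k a b assume c: "c \<in> A" "q \<in> fst c"
    note lin = Dg_linear[OF c(1) chart_slice_in[OF c]]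
    let ?F = "\<lambda>a b. frechet_derivative
      (local_rep (leaf_atlas A q) (\<lambda>Z v w. Lm Z (leaf_J Z v) w) (LC q c) a b) (at (y, 0))"
    \<comment> \<open>The exterior derivative on (k, 0), (a, 0), (0, b). Only the last vector has an
      \<eta>-part, so two of the six terms survive, and they differ by exchanging k and a.\<close>
    have "?F (a, 0) (0, b) (k, 0) - ?F (k, 0) (0, b) (a, 0) + ?F (k, 0) (a, 0) (0, b) = 0"
    proof -
      have "(y, 0) \<in> snd (LC q c) ` fst (LC q c)" unfolding fst_LC LC_range[OF c] by simp
      with closed LC_in[OF c] show ?thesis unfolding closed_2form_def by blast
    qed
    then show "Dg c (snd c q, y) k a b = Dg c (snd c q, y) a k b"
      unfolding leaf_form_derivative[OF c]
      by (simp add: linear_0[OF lin(1)] linear_0[OF lin(2)] linear_0[OF lin(3)])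
  qed
next
  assume sym: "fibre_symmetric q"
  show "closed_2form (leaf_atlas A q) (\<lambda>Z v w. Lm Z (leaf_J Z v) w)"
    unfolding closed_2form_def
  proof (intro ballI allI)
    fix C and u a b e :: "(real^'m) \<times> (real^'m)"
    assume "C \<in> leaf_atlas A q"
    then obtain c where c: "c \<in> A" "q \<in> fst c" "C = LC q c" by (rule in_leaf_atlas)
    let ?D = "Dg c (snd c q, fst u)"
    have 1: "?D k a b = ?D a k b" for k a b
      using sym c unfolding fibre_symmetric_def by blast
    have 2: "?D k a b = ?D k b a" for k a b by (rule Dg_sym[OF c(1) chart_slice_in[OF c(1,2)]])
    \<comment> \<open>The six terms cancel in pairs with the same \<eta>-vector; each equation
      matches one such pair.\<close>
    have "?D (fst a) (snd b) (fst e) = ?D (fst e) (fst a) (snd b)"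
      "?D (fst b) (snd a) (fst e) = ?D (fst e) (snd a) (fst b)"
      "?D (fst a) (fst b) (snd e) = ?D (fst b) (fst a) (snd e)"
      using 1 2 by metis+
    then show "frechet_derivative (local_rep (leaf_atlas A q) (\<lambda>Z v w. Lm Z (leaf_J Z v) w) C b e) (at u) a
        - frechet_derivative (local_rep (leaf_atlas A q) (\<lambda>Z v w. Lm Z (leaf_J Z v) w) C a e) (at u) b
        + frechet_derivative (local_rep (leaf_atlas A q) (\<lambda>Z v w. Lm Z (leaf_J Z v) w) C a b) (at u) e = 0"
      unfolding c(3) leaf_form_derivative[OF c(1,2)] by simp
  qed
qed

lemma pseudo_kaehler_leaf_iff: "pseudo_kaehler (leaf_atlas A q) leaf_J Lm \<longleftrightarrow> fibre_symmetric q"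
  unfolding pseudo_kaehler_def carrier_of_leaf[OF q] closed_leaf_form_iff
  using complex_structure_leaf pseudo_riemannian_leaf leaf_metric_J by blast

end

end

section \<open>Local Lagrangians\<close>

context atlas
begin

lemma topspace_atlas_topology: "topspace (atlas_topology A) = carrier_of A"
proof
  have "openin (atlas_topology A) (topspace (atlas_topology A))" by (rule openin_topspace)
  then show "topspace (atlas_topology A) \<subseteq> carrier_of A"
    unfolding openin_atlas_topology[OF smooth_atlas] by blast
  have "carrier_of A \<inter> fst c = fst c" if "c \<in> A" for c
    using that by (auto simp: carrier_of_def)
  then have "openin (atlas_topology A) (carrier_of A)"
    unfolding openin_atlas_topology[OF smooth_atlas] using chart_open by simp
  then show "carrier_of A \<subseteq> topspace (atlas_topology A)" by (rule openin_subset)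
qed

lemma continuous_map_atlas_topology:
  assumes "\<And>c. c \<in> A \<Longrightarrow> continuous_on (snd c ` fst c) (f \<circ> cinv c)"
  shows "continuous_map (atlas_topology A) euclideanreal f"
  unfolding continuous_map_def topspace_atlas_topology
proof (intro conjI allI impI)
  fix U :: "real set" assume "openin euclidean U"
  then have U: "open U" by simp
  show "openin (atlas_topology A) {x \<in> carrier_of A. f x \<in> U}"
    unfolding openin_atlas_topology[OF smooth_atlas]
  proof (intro conjI ballI)
    fix c assume c: "c \<in> A"
    have "{x \<in> carrier_of A. f x \<in> U} \<inter> fst c = {x \<in> fst c. f x \<in> U}"
      using c unfolding carrier_of_def by blast
    moreover have "snd c ` {x \<in> fst c. f x \<in> U} = snd c ` fst c \<inter> (f \<circ> cinv c) -` U"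
      by (auto simp: cinv_apply[OF c])
    ultimately have "snd c ` ({x \<in> carrier_of A. f x \<in> U} \<inter> fst c) = snd c ` fst c \<inter> (f \<circ> cinv c) -` U"
      by simp
    then show "open (snd c ` ({x \<in> carrier_of A. f x \<in> U} \<inter> fst c))"
      using continuous_open_preimage[OF assms[OF c] chart_open[OF c] U] by simp
  qed auto
qed auto

end

context tangent_metric_manifold
begin

lemma gform_transition:
  assumes "c \<in> A" "p \<in> fst c" "d \<in> A" "p \<in> fst d"
  shows "gform d (jac c d p a) (jac c d p b) (snd d p, jac c d p y) = gform c a b (snd c p, y)"
proof -
  have p: "snd c p \<in> snd c ` fst c" "snd d p \<in> snd d ` fst d" using assms by auto
  have "tvec_of A d p (jac c d p y) = tvec_of A c p y"
    using assms by (intro tangent_space_eqI[of d p] tvec_of_in)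
      (simp_all add: tvec_of_self, simp add: tvec_of_apply)
  then have "cinv (TC d) (snd d p, jac c d p y) = (p, tvec_of A c p y)"
    "cinv (TC c) (snd c p, y) = (p, tvec_of A c p y)"
    using assms by (simp_all add: cinv_TC[OF _ p(1)] cinv_TC[OF _ p(2)] cinv_apply)
  then show ?thesis
    using fform_transition[OF tangent_bundle_tvec_of[OF assms(1,2), of y], of c d] assms
    by (simp add: gform_def)
qed

text \<open>Two nested ray integrals: the inner one is the first potential with index y, evaluated
  at (x, s y). This puts s y into the first slot of g and turns the ray parameter t into t
  s.\<close>

definition lagr_at :: "('a, real^'m) chart \<Rightarrow> (real^'m) \<times> (real^'m) \<Rightarrow> real" where
  "lagr_at c u = integral {0..1} (\<lambda>s. integral {0..1} (\<lambda>t.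
     gform c (s *\<^sub>R snd u) (snd u) (fst u, t *\<^sub>R s *\<^sub>R snd u)))"

definition lagrangian :: "('a, 'm) tpt \<Rightarrow> real" where
  "lagrangian \<xi> = (let c = (SOME c. c \<in> A \<and> fst \<xi> \<in> fst c) in lagr_at c (snd (TC c) \<xi>))"

text \<open>A linear Jacobian commutes with the scalings by s and t, so the tensor law for g makes
  the integrands in two charts equal for every s and t.\<close>

lemma lagrangian_eq:
  assumes "\<xi> \<in> tangent_bundle A" "c \<in> A" "fst \<xi> \<in> fst c"
  shows "lagrangian \<xi> = lagr_at c (snd (TC c) \<xi>)"
proof -
  define d where "d = (SOME c. c \<in> A \<and> fst \<xi> \<in> fst c)"
  have d: "d \<in> A" "fst \<xi> \<in> fst d"
    using someI[of "\<lambda>c. c \<in> A \<and> fst \<xi> \<in> fst c" c] assms by (auto simp: d_def)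
  let ?J = "jac d c (fst \<xi>)"
  have J: "linear ?J" by (rule linear_jac[OF d(1) assms(2) d(2) assms(3)])
  have y: "snd \<xi> c = ?J (snd \<xi> d)"
    using tangent_space_jac[OF tangent_bundleD[OF assms(1)] d(1) assms(2) d(2) assms(3)] by simp
  have "lagr_at c (snd (TC c) \<xi>) = lagr_at d (snd (TC d) \<xi>)"
    unfolding lagr_at_def snd_TC fst_conv snd_conv y linear_cmul[OF J, symmetric]
      gform_transition[OF d assms(2,3)] ..
  then show ?thesis by (simp add: lagrangian_def d_def Let_def)
qed

text \<open>For fixed e the fibre 1-form a to g(a, e) is closed by fibre symmetry, and
  \<open>M e\<close> is its potential. In turn e to \<open>M e\<close> is a fibre 1-form, and
  \<open>lagr_at c\<close> is a potential of that one. Its first fibre derivatives are thus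
  \<open>M b\<close>, and its second ones g.\<close>

lemma lagr_at_potential:
  assumes c: "c \<in> A" and sym: "\<And>q. q \<in> fst c \<Longrightarrow> fibre_symmetric q"
  defines "S \<equiv> snd c ` fst c \<times> (UNIV :: (real^'m) set)"
    and "M \<equiv> \<lambda>e u. integral {0..1} (\<lambda>t. gform c (snd u) e (fst u, t *\<^sub>R snd u))"
  shows "smooth_on S (lagr_at c)"
    and "u \<in> S \<Longrightarrow> frechet_derivative (lagr_at c) (at u) (0, b) = M b u"
    and "u \<in> S \<Longrightarrow> (M e has_derivative frechet_derivative (M e) (at u)) (at u)"
    and "u \<in> S \<Longrightarrow> frechet_derivative (M e) (at u) (0, b) = gform c b e u"
proof -
  note U = chart_open[OF c] and sm = smooth_on_gform[OF c]
    and bl = bilinear_linear[OF bilinear_gform[OF c]]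
  have closed: "frechet_derivative (gform c a e) (at u) (0, b) = frechet_derivative (gform c b e) (at u) (0, a)"
    if u: "u \<in> snd c ` fst c \<times> UNIV" for u a b e
  proof -
    obtain q y where "u = (snd c q, y)" "q \<in> fst c" using u by (metis imageE mem_Sigma_iff surj_pair)
    then show ?thesis using sym[of q] c unfolding fibre_symmetric_def Dg_def by blast
  qed
  have smM: "smooth_on S (M e)" and DM: "u \<in> S \<Longrightarrow> frechet_derivative (M e) (at u) (0, b) = gform c b e u"
    for e u b
    unfolding S_def M_def
    using fibrewise_poincare[OF U, of "\<lambda>a. gform c a e"] sm bl(1) closed by blast+
  show "u \<in> S \<Longrightarrow> (M e has_derivative frechet_derivative (M e) (at u)) (at u)"
    by (rule smooth_on_has_derivative[OF smM])
  show "u \<in> S \<Longrightarrow> frechet_derivative (M e) (at u) (0, b) = gform c b e u"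
    by (rule DM)
  have linM: "linear (\<lambda>e. M e u)" if "u \<in> S" for u
    unfolding M_def
  proof (rule linear_integral)
    have u: "(fst u, y) \<in> snd c ` fst c \<times> UNIV" for y using that by (auto simp: S_def)
    show "linear (\<lambda>e. gform c (snd u) e (fst u, t *\<^sub>R snd u))" for t
      by (rule bl(2)[OF u])
    show "continuous_on {0..1} (\<lambda>t. gform c (snd u) e (fst u, t *\<^sub>R snd u))" for e
      using u by (intro continuous_on_ray[OF smooth_on_imp_continuous_on[OF sm]]) auto
  qed
  \<comment> \<open>The fibre derivative of \<open>M a\<close> along b is g(b, a), so the second
    closedness condition is just the symmetry of g.\<close>
  have closedM: "frechet_derivative (M a) (at u) (0, b) = frechet_derivative (M b) (at u) (0, a)"
    if "u \<in> S" for u a b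
    using gform_sym[OF c] that by (simp add: DM[OF that]) (simp add: S_def)
  have L: "lagr_at c = (\<lambda>u. integral {0..1} (\<lambda>s. M (snd u) (fst u, s *\<^sub>R snd u)))"
    by (simp add: lagr_at_def[abs_def] M_def)
  note P = fibrewise_poincare[OF U smM[unfolded S_def] linM[unfolded S_def] closedM[unfolded S_def]]
  show "smooth_on S (lagr_at c)" unfolding L S_def by (rule P(1))
  show "frechet_derivative (lagr_at c) (at u) (0, b) = M b u" if "u \<in> S"
    unfolding L by (rule P(2)) (use that in \<open>simp_all add: S_def\<close>)
qed

lemma locally_lagrange_if_fibre_symmetric:
  assumes "\<And>q. q \<in> carrier_of A \<Longrightarrow> fibre_symmetric q"
  shows "locally_lagrange A \<gamma>"
proof -
  have sym: "\<And>q. q \<in> fst c \<Longrightarrow> fibre_symmetric q" if "c \<in> A" for c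
    using that by (intro assms) (auto simp: carrier_of_def)
  let ?S = "\<lambda>c. snd c ` fst c \<times> (UNIV :: (real^'m) set)"
  have rep: "(lagrangian \<circ> cinv (TC c)) u = lagr_at c u" if "c \<in> A" "u \<in> ?S c" for c u
    using lagrangian_eq[OF cinv_TC_point(1)[OF that] that(1) cinv_TC_point(2)[OF that]]
      apply_cinv[of u "TC c"] TC_range[OF that(1)] that(2) by simp
  have smooth: "smooth_on (?S c) (lagrangian \<circ> cinv (TC c))" if "c \<in> A" for c
    using rep[OF that] by (intro smooth_on_cong[OF open_TC_range[OF that] lagr_at_potential(1)[OF that sym[OF that]]]) auto
  have "lagrange_on A \<gamma> (tangent_bundle A) lagrangian"
    unfolding lagrange_on_def
  proof (intro conjI ballI impI allI)
    show "continuous_map (subtopology (atlas_topology (tangent_atlas A)) (tangent_bundle A))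
        euclideanreal lagrangian"
    proof (intro continuous_map_from_subtopology T.continuous_map_atlas_topology)
      fix C assume "C \<in> tangent_atlas A"
      then obtain c where "c \<in> A" "C = TC c" by (auto simp: tangent_atlas_def)
      then show "continuous_on (snd C ` fst C) (lagrangian \<circ> cinv C)"
        using smooth_on_imp_continuous_on[OF smooth] by (simp add: TC_range)
    qed
    show "smooth_function_on (tangent_atlas A) (tangent_bundle A - zero_section A) lagrangian"
      unfolding smooth_function_on_def
    proof
      fix C assume "C \<in> tangent_atlas A"
      then obtain c where "c \<in> A" "C = TC c" by (auto simp: tangent_atlas_def)
      moreover from this have "snd C ` ((tangent_bundle A - zero_section A) \<inter> fst C) \<subseteq> ?S c"
        using TC_range[of c] by blast
      ultimately show
        "smooth_on (snd C ` ((tangent_bundle A - zero_section A) \<inter> fst C)) (lagrangian \<circ> cinv C)"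
        using smooth_on_subset[OF smooth] by simp
    qed
    fix \<xi> c i j assume "\<xi> \<in> tangent_bundle A - zero_section A" and c: "c \<in> A" "fst \<xi> \<in> fst c"
    then have \<xi>: "\<xi> \<in> tangent_bundle A" by simp
    let ?u = "snd (TC c) \<xi>"
    have u: "?u \<in> ?S c" using c by (simp add: snd_TC)
    have cinv: "cinv (TC c) ?u = \<xi>" using T.cinv_apply[OF TC_point[OF \<xi> c]] .
    note pot = lagr_at_potential[OF c(1) sym[OF c(1)]] and S = open_TC_range[OF c(1)]
    let ?M = "\<lambda>e u. integral {0..1} (\<lambda>t. gform c (snd u) e (fst u, t *\<^sub>R snd u))"
    have "frechet_derivative (lagrangian \<circ> cinv (TC c)) (at w) (0, axis j 1) = ?M (axis j 1) w"
      if w: "w \<in> ?S c" for w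
    proof -
      \<comment> \<open>\<open>lagrangian\<close> in coordinates agrees with
        \<open>lagr_at c\<close> on the chart range only; openness of the range suffices to transfer
        derivatives.\<close>
      have "frechet_derivative (lagrangian \<circ> cinv (TC c)) (at w) = frechet_derivative (lagr_at c) (at w)"
        by (rule frechet_derivative_cong_open[OF smooth_on_has_derivative[OF pot(1) w] S w])
          (use rep[OF c(1)] in auto)
      then show ?thesis using pot(2)[OF _ w] by simp
    qed
    then have "frechet_derivative (\<lambda>w. frechet_derivative (lagrangian \<circ> cinv (TC c)) (at w) (0, axis j 1))
        (at ?u) = frechet_derivative (?M (axis j 1)) (at ?u)"
      by (intro frechet_derivative_cong_open[OF pot(3)[OF _ u] S u]) auto
    then have "fibre_hessian A lagrangian c i j \<xi> = gform c (axis i 1) (axis j 1) ?u"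
      unfolding fibre_hessian_def Let_def using pot(4)[OF _ u] by simp
    then show "gcomp A \<gamma> c i j \<xi> = fibre_hessian A lagrangian c i j \<xi>"
      using gcomp_eq_fform[OF \<xi> c] by (simp add: gform_def cinv)
  qed
  moreover have "openin (atlas_topology (tangent_atlas A)) (tangent_bundle A)"
    using openin_topspace[of "atlas_topology (tangent_atlas A)"]
    by (simp add: T.topspace_atlas_topology carrier_of_TC)
  ultimately show ?thesis unfolding locally_lagrange_def by blast
qed

text \<open>Where \<open>g_ij\<close> is the fibre Hessian of L, \<open>Dg\<close> on coordinate
  vectors k, i, j is the second derivative of dL/dy^j along y^i and y^k, so Schwarz' theorem applies
  to dL/dy^j.\<close>

lemma Dg_axis_symmetric_off_zero:
  assumes lagr: "locally_lagrange A \<gamma>" and c: "c \<in> A" and u: "u \<in> snd c ` fst c \<times> UNIV" "snd u \<noteq> 0"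
  shows "Dg c u (axis k 1) (axis i 1) (axis j 1) = Dg c u (axis i 1) (axis k 1) (axis j 1)"
proof -
  let ?C = "TC c"
  obtain W L where W: "openin (atlas_topology (tangent_atlas A)) W" "cinv ?C u \<in> W"
    and L: "lagrange_on A \<gamma> W L"
    using lagr cinv_TC_point(1)[OF c u(1)] unfolding locally_lagrange_def by blast
  \<comment> \<open>The Hessian identity is to be differentiated and must hold on an open set.
    Removing y = 0 removes the zero section, leaving points where L is smooth and the identity is
    imposed.\<close>
  let ?O = "snd ?C ` (W \<inter> fst ?C) \<inter> {w. snd w \<noteq> 0}"
  have "open (snd ?C ` (W \<inter> fst ?C))"
    using W(1) TC_in[OF c] unfolding openin_atlas_topology[OF smooth_atlas_TC] by blast
  moreover have "open {w :: (real^'m) \<times> (real^'m). snd w \<noteq> 0}"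
    by (intro open_Collect_neq continuous_intros)
  ultimately have O: "open ?O" by (rule open_Int)
  have "u \<in> snd ?C ` fst ?C" using u(1) TC_range[OF c] by simp
  then have "u = snd ?C (cinv ?C u)" "cinv ?C u \<in> fst ?C" by (simp_all add: apply_cinv cinv_in)
  then have uO: "u \<in> ?O" using W(2) u(2) by blast
  have point: "cinv ?C w \<in> W - zero_section A" "cinv ?C w \<in> fst ?C" "snd ?C (cinv ?C w) = w"
    if w: "w \<in> ?O" for w
  proof -
    obtain \<xi> where \<xi>: "\<xi> \<in> W" "\<xi> \<in> fst ?C" "w = snd ?C \<xi>" "snd w \<noteq> 0" using w by auto
    then have "cinv ?C w = \<xi>" using T.cinv_apply[OF TC_in[OF c]] by simp
    moreover have "\<xi> \<notin> zero_section A" using \<xi>(3,4) by (auto simp: zero_section_def snd_TC)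
    ultimately show "cinv ?C w \<in> W - zero_section A" "cinv ?C w \<in> fst ?C" "snd ?C (cinv ?C w) = w"
      using \<xi> by simp_all
  qed
  define F where "F = L \<circ> cinv ?C"
  have "smooth_on (snd ?C ` ((W - zero_section A) \<inter> fst ?C)) F"
    using L TC_in[OF c] unfolding lagrange_on_def smooth_function_on_def F_def by blast
  moreover have "?O \<subseteq> snd ?C ` ((W - zero_section A) \<inter> fst ?C)"
  proof
    fix w assume "w \<in> ?O"
    from point[OF this] show "w \<in> snd ?C ` ((W - zero_section A) \<inter> fst ?C)"
      by (intro image_eqI[of w _ "cinv ?C w"]) simp_all
  qed
  ultimately have F: "smooth_on ?O F" by (rule smooth_on_subset)
  define f where "f = (\<lambda>w. frechet_derivative F (at w) (0, axis j 1))"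
  have f: "smooth_on ?O f" unfolding f_def by (rule smooth_on_derivative[OF F])
  have hess: "frechet_derivative f (at w) (0, axis i 1) = gform c (axis i 1) (axis j 1) w"
    if w: "w \<in> ?O" for w i
  proof -
    note p = point[OF w]
    have "gcomp A \<gamma> c i j (cinv ?C w) = fibre_hessian A L c i j (cinv ?C w)"
      using L p c unfolding lagrange_on_def by (auto simp: in_TC)
    moreover have "gcomp A \<gamma> c i j (cinv ?C w) = gform c (axis i 1) (axis j 1) w"
      using gcomp_eq_fform[OF _ c] p(2) by (simp add: in_TC gform_def)
    ultimately show ?thesis
      unfolding fibre_hessian_def Let_def p(3) f_def F_def by simp
  qed
  have D: "Dg c u k' (axis i 1) (axis j 1) =
      frechet_derivative (\<lambda>w. frechet_derivative f (at w) (0, axis i 1)) (at u) (0, k')" for i k'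
    unfolding Dg_def
    by (subst frechet_derivative_cong_open[OF
          smooth_on_has_derivative[OF smooth_on_derivative[OF f] uO] O uO hess]) simp_all
  show ?thesis
    unfolding D
    using f by (intro second_derivative_symmetric[OF O _ uO]) (simp add: smooth_on_def)
qed

text \<open>The symmetry known for y different from 0 is a closed condition on y, since \<gamma> and
  hence \<open>Dg\<close> is continuous on the entire fibre.\<close>

lemma fibre_symmetric_if_locally_lagrange:
  assumes "locally_lagrange A \<gamma>"
  shows "fibre_symmetric q"
  unfolding fibre_symmetric_def
proof (intro ballI impI allI)
  fix c y k a b assume c: "c \<in> A" "q \<in> fst c"
  let ?D = "\<lambda>y. Dg c (snd c q, y)"
  have u: "(snd c q, y) \<in> snd c ` fst c \<times> UNIV" for y :: "real^'m" using c by simp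
  \<comment> \<open>Multilinearity passes from coordinate vectors to all arguments: first the pair
    k, a with the last argument on an axis, then b.\<close>
  have off: "?D y k a b = ?D y a k b" if "y \<noteq> 0" for y k a b
  proof -
    note lin = Dg_linear[OF c(1) u[of y]]
    have "(\<lambda>k a. ?D y k a (axis j 1)) = (\<lambda>k a. ?D y a k (axis j 1))" for j
    proof (rule bilinear_eq_stdbasis)
      show "bilinear (\<lambda>k a. ?D y k a (axis j 1))" "bilinear (\<lambda>k a. ?D y a k (axis j 1))"
        using lin by (auto simp: bilinear_def)
    next
      fix i k :: "real^'m" assume "i \<in> Basis" "k \<in> Basis"
      then obtain i' k' where "i = axis i' 1" "k = axis k' 1" by (metis basis_axis)
      then show "?D y i k (axis j 1) = ?D y k i (axis j 1)"
        using Dg_axis_symmetric_off_zero[OF assms c(1) u] that by simp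
    qed
    then have 1: "?D y k a (axis j 1) = ?D y a k (axis j 1)" for j by meson
    have "?D y k a = ?D y a k"
      by (rule linear_eq_stdbasis[OF lin(3) lin(3)]) (metis 1 basis_axis)
    then show ?thesis by simp
  qed
  have cont: "continuous_on UNIV (\<lambda>y. ?D y k a b)" for k a b
    unfolding Dg_def
    by (rule continuous_on_compose2[OF
          smooth_on_imp_continuous_on[OF smooth_on_derivative[OF smooth_on_gform[OF c(1)]]]])
      (use u in \<open>auto intro!: continuous_intros\<close>)
  have "closed {y. ?D y k a b = ?D y a k b}"
    using cont by (intro closed_Collect_eq) auto
  \<comment> \<open>The complement of the origin is dense because \<open>real^'m\<close> has
    positive dimension, the index type being nonempty.\<close>
  moreover have "- {0} \<subseteq> {y. ?D y k a b = ?D y a k b}" using off by auto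
  ultimately have "closure (- {0}) \<subseteq> {y. ?D y k a b = ?D y a k b}"
    by (intro closure_minimal)
  then show "?D y k a b = ?D y a k b" by (auto simp: closure_complement)
qed

end

theorem proposition2p2:
  fixes A :: "('a, real^'m::finite) chart set"
    and \<gamma> :: "('a, 'm) metric_TM"
    and G :: "('a, 'm) metric_TV"
  assumes "smooth_manifold A"
    and "tangent_metric A \<gamma>"
    and "is_extension A \<gamma> G"
  shows "(\<forall>q\<in>carrier_of A. pseudo_kaehler (leaf_atlas A q) leaf_J (leaf_metric A q G)) \<longleftrightarrow>
         locally_lagrange A \<gamma>"
proof -
  interpret extension_manifold A \<gamma> G
    using assms by unfold_locales (auto simp: smooth_manifold_def)
  \<comment> \<open>Both sides amount to \<open>fibre_symmetric q\<close> at every point q of the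
    base.\<close>
  show ?thesis
    using pseudo_kaehler_leaf_iff locally_lagrange_if_fibre_symmetric
      fibre_symmetric_if_locally_lagrange by blast
qed

end
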